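(* Let $X_n=G(\ldots,\varepsilon_{n-1},\varepsilon_n)$ be the stationary process described in the context and assume that it is geometric-moment contracting, i.e. there exist $\alpha>0$, $C=C(\alpha)>0$ and $0<r=r(\alpha)<1$ such that for all $n\ge0$ $$\mathbb{E}\bigl[|G(\ldots,\varepsilon_{-1},\varepsilon_0,\varepsilon_1,\ldots,\varepsilon_n)-G(\ldots,\varepsilon_{-1}',\varepsilon_0',\varepsilon_1,\ldots,\varepsilon_n)|^\alpha\bigr]\le Cr^n.$$ Assume also $\sup_x[f(x)+|f'(x)|]<\infty$ and $\inf_{p_0\le p\le p_1}f(\xi_p)>0$ for some $0<p_0<p_1<1$. Then $$\sup_{p_0\le p\le p_1}\left|\xi_{n,p}-\xi_p-\frac{p-F_n(\xi_p)}{f(\xi_p)}\right|=O_{\mathrm{a.s.}}(n^{-3/4}\log^{3/2}n).$$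
   Context: $(\varepsilon_k)_{k\in\mathbb{Z}}$ are i.i.d. random variables, $G$ is a measurable function such that $X_n=G(\ldots,\varepsilon_{n-1},\varepsilon_n)$ is a well-defined (real) random variable, and $(\varepsilon_k')_{k\in\mathbb{Z}}$ is an i.i.d. sequence, independent of $(\varepsilon_k)_{k\in\mathbb{Z}}$, with $\varepsilon'_k$ distributed as $\varepsilon_0$. $F$ and $f$ are the marginal distribution function and density of $X_n$; $\xi_p=\inf\{x:F(x)\ge p\}$. Given $X_1,\dots,X_n$, $F_n(x)=\frac1n\sum_{i=1}^n\mathbf 1_{X_i\le x}$ and $\xi_{n,p}=\inf\{x:F_n(x)\ge p\}$. A sequence of random variables $Z_n$ is $O_{\mathrm{a.s.}}(r_n)$ if $Z_n/r_n$ is almost surely bounded. *)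

theory Defs
  imports "HOL-Probability.Probability"
begin

definition iid_process ::
    "'w measure \<Rightarrow> 'e measure \<Rightarrow> (int \<Rightarrow> 'w \<Rightarrow> 'e) \<Rightarrow> bool" where
  "iid_process M S \<epsilon> \<longleftrightarrow>
     prob_space.indep_vars M (\<lambda>_. S) \<epsilon> UNIV \<and>
     (\<forall>k. distr M S (\<epsilon> k) = distr M S (\<epsilon> 0))"

text \<open>Processes are independent when they are independent as random elements of the
  product space over all integer times.\<close>

definition independent_copy ::
    "'w measure \<Rightarrow> 'e measure \<Rightarrow> (int \<Rightarrow> 'w \<Rightarrow> 'e) \<Rightarrow> (int \<Rightarrow> 'w \<Rightarrow> 'e) \<Rightarrow> bool" where
  "independent_copy M S \<epsilon> \<epsilon>' \<longleftrightarrow>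
     iid_process M S \<epsilon>' \<and>
     (\<forall>k. distr M S (\<epsilon>' k) = distr M S (\<epsilon> 0)) \<and>
     prob_space.indep_var M
       (PiM UNIV (\<lambda>_. S)) (\<lambda>\<omega> k. \<epsilon> k \<omega>)
       (PiM UNIV (\<lambda>_. S)) (\<lambda>\<omega> k. \<epsilon>' k \<omega>)"

text \<open>A left-infinite sequence \<open>(\<dots>, x\<^bsub>n-1\<^esub>, x\<^bsub>n\<^esub>)\<close> is represented by lags: the function
  \<open>\<lambda>j. x (n - j)\<close> on the natural numbers, so lag 0 is the most recent entry.\<close>

definition causal_process ::
    "((nat \<Rightarrow> 'e) \<Rightarrow> real) \<Rightarrow> (int \<Rightarrow> 'w \<Rightarrow> 'e) \<Rightarrow> int \<Rightarrow> 'w \<Rightarrow> real" where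
  "causal_process G \<epsilon> n \<omega> = G (\<lambda>j. \<epsilon> (n - int j) \<omega>)"

definition coupled_innovations ::
    "(int \<Rightarrow> 'w \<Rightarrow> 'e) \<Rightarrow> (int \<Rightarrow> 'w \<Rightarrow> 'e) \<Rightarrow> int \<Rightarrow> 'w \<Rightarrow> 'e" where
  "coupled_innovations \<epsilon> \<epsilon>' k = (if k \<le> 0 then \<epsilon>' k else \<epsilon> k)"

text \<open>The moment is an extended nonnegative integral, so the bound includes its finiteness.\<close>

definition geometric_moment_contracting ::
    "'w measure \<Rightarrow> ((nat \<Rightarrow> 'e) \<Rightarrow> real) \<Rightarrow>
       (int \<Rightarrow> 'w \<Rightarrow> 'e) \<Rightarrow> (int \<Rightarrow> 'w \<Rightarrow> 'e) \<Rightarrow> bool" where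
  "geometric_moment_contracting M G \<epsilon> \<epsilon>' \<longleftrightarrow>
     (\<exists>\<alpha> C r. 0 < \<alpha> \<and> 0 < C \<and> 0 < r \<and> r < 1 \<and>
        (\<forall>n::nat.
           (\<integral>\<^sup>+ \<omega>. ennreal (\<bar>causal_process G \<epsilon> (int n) \<omega>
                - causal_process G (coupled_innovations \<epsilon> \<epsilon>') (int n) \<omega>\<bar> powr \<alpha>) \<partial>M)
           \<le> ennreal (C * r ^ n)))"

definition empirical_cdf :: "(int \<Rightarrow> 'w \<Rightarrow> real) \<Rightarrow> nat \<Rightarrow> 'w \<Rightarrow> real \<Rightarrow> real" where
  "empirical_cdf X n \<omega> x = (\<Sum>i=1..n. indicator {..x} (X (int i) \<omega>)) / real n"

definition quantile :: "(real \<Rightarrow> real) \<Rightarrow> real \<Rightarrow> real" where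
  "quantile H p = Inf {x. p \<le> H x}"

text \<open>The bound on \<open>Z n \<omega> / r n\<close> may depend on \<open>\<omega>\<close>.  Since \<open>x / 0 = 0\<close>, indices with
  \<open>r n = 0\<close> are disregarded.\<close>

definition O_as :: "'w measure \<Rightarrow> (nat \<Rightarrow> 'w \<Rightarrow> real) \<Rightarrow> (nat \<Rightarrow> real) \<Rightarrow> bool" where
  "O_as M Z r \<longleftrightarrow> (AE \<omega> in M. Bseq (\<lambda>n. Z n \<omega> / r n))"

end

theory Submission
  imports Defs "HOL-Real_Asymp.Real_Asymp"
begin

text \<open>Cutting the past of \<open>X\<^sub>i\<close> off at lag \<open>m\<close>, of order \<open>ln n\<close>, changes it by at most \<open>1 / n^2\<close> outside an
  event of polynomially small probability, by geometric-moment contraction. The truncated variables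
  split into \<open>m\<close> independent subsequences, so a Bernstein bound on each shows that the number of
  \<open>X\<^sub>i\<close> in an interval of probability \<open>Q\<close> deviates from its mean by \<open>O(sqrt (n * Q) * ln n)\<close>. A union
  bound over a grid and the Borel--Cantelli lemma make this uniform. With \<open>Q = 1\<close> it gives
  \<open>F\<^sub>n - F = O(ln n / sqrt n)\<close>, hence the same rate for the sample quantiles; with \<open>Q\<close> of the
  order \<open>ln n / sqrt n\<close> it bounds the oscillation of \<open>F\<^sub>n - F\<close> between \<open>\<xi>\<^sub>p\<close> and the sample
  quantile by the claimed rate, and a second-order Taylor expansion of \<open>F\<close> at \<open>\<xi>\<^sub>p\<close> concludes.\<close>

section \<open>Bernstein bounds\<close>

text \<open>The contraction hypothesis bounds a moment of the distance between coupled paths,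
  whereas an empirical distribution function counts indicators, which are discontinuous. The bounded
  density bridges the two: moving an endpoint by d costs probability at most L d, so an error of
  n^-2 in the variables is negligible. The bound must be sensitive to the variance because of the
  oscillation step: sample and true quantile are within b = O(n^(-1/2) ln n), increments over such
  distances have Q of the same order, and sqrt (n Q) ln n / n is then of order n^(-3/4) (ln
  n)^(3/2); one logarithm comes from the deviation bound and half of one from Q. The Taylor
  remainder O(b^2) = O((ln n)^2 / n) and the mesh error O(1 / n) are smaller. Uniformity in p costs
  no further probability: the quantiles concerned lie in one bounded interval, where a mesh of 1 / n
  has O(n^2) pairs of points, and failure probabilities n^-4 leave a summable n^-2. On the resulting
  almost sure event the rest is a deterministic statement about a monotone function close to
  F.\<close>

lemma exp_le_quadratic:
  fixes x :: real
  assumes "\<bar>x\<bar> \<le> 1"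
  shows "exp x \<le> 1 + x + x\<^sup>2"
proof (cases "0 \<le> x")
  case True
  then show ?thesis using assms exp_bound by auto
next
  case False
  define y where "y = - x"
  have y: "0 < y" using False by (simp add: y_def)
  \<comment> \<open>The factor 1 + y of 1 + y^3 may be enlarged to exp y because its cofactor is
    nonnegative; dividing by exp y gives the bound at x = - y.\<close>
  have "1 \<le> 1 + y ^ 3" using y by simp
  also have "\<dots> = (1 - y + y\<^sup>2) * (1 + y)" by (simp add: algebra_simps power2_eq_square power3_eq_cube)
  also have "\<dots> \<le> (1 - y + y\<^sup>2) * exp y"
  proof (rule mult_left_mono)
    show "1 + y \<le> exp y" by (rule exp_ge_add_one_self)
    have "0 \<le> (1 - y)\<^sup>2 + y" using y by (intro add_nonneg_nonneg) auto
    then show "0 \<le> 1 - y + y\<^sup>2" using y by (simp add: power2_eq_square algebra_simps)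
  qed
  finally have "exp (- y) \<le> 1 - y + y\<^sup>2"
    by (simp add: exp_minus field_simps)
  then show ?thesis by (simp add: y_def)
qed

text \<open>Chernoff's method. The quadratic bound on exp applies because l and all |Z i| are at
  most 1; mean zero removes the linear term, and independence multiplies the moment generating
  functions. The parameter l stays free, since its best choice depends on the block length and on
  the size of v.\<close>

lemma (in prob_space) bernstein_indep:
  fixes Z :: "'i \<Rightarrow> 'a \<Rightarrow> real" and l s v :: real
  assumes fin: "finite I" and ind: "indep_vars (\<lambda>_. borel) Z I"
    and bound: "\<And>i \<omega>. i \<in> I \<Longrightarrow> \<bar>Z i \<omega>\<bar> \<le> 1"
    and mean: "\<And>i. i \<in> I \<Longrightarrow> expectation (Z i) = 0"
    and var: "\<And>i. i \<in> I \<Longrightarrow> expectation (\<lambda>\<omega>. (Z i \<omega>)\<^sup>2) \<le> v"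
    and l: "0 < l" "l \<le> 1"
  shows "prob {\<omega>\<in>space M. s \<le> (\<Sum>i\<in>I. Z i \<omega>)} \<le> exp (- l * s + l\<^sup>2 * (card I * v))"
proof -
  have rv[measurable]: "random_variable borel (Z i)" if "i \<in> I" for i
    using ind that by (auto simp: indep_vars_def)
  have [measurable]: "(\<lambda>\<omega>. \<Sum>i\<in>I. Z i \<omega>) \<in> borel_measurable M"
    by (intro borel_measurable_sum) auto
  have mgf: "(\<integral>\<^sup>+\<omega>. ennreal (exp (l * Z i \<omega>)) \<partial>M) \<le> ennreal (exp (l\<^sup>2 * v))" if i: "i \<in> I" for i
  proof -
    have Zm[measurable]: "random_variable borel (Z i)" using rv i by auto
    have int1: "integrable M (Z i)"
      using bound[OF i] by (intro integrable_const_bound[where B=1]) auto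
    have int2: "integrable M (\<lambda>\<omega>. (Z i \<omega>)\<^sup>2)"
      using bound[OF i] by (intro integrable_const_bound[where B=1]) (auto simp: abs_square_le_1)
    have "(\<integral>\<^sup>+\<omega>. ennreal (exp (l * Z i \<omega>)) \<partial>M) \<le> (\<integral>\<^sup>+\<omega>. ennreal (1 + l * Z i \<omega> + l\<^sup>2 * (Z i \<omega>)\<^sup>2) \<partial>M)"
    proof (intro nn_integral_mono ennreal_leI)
      fix \<omega>
      have "\<bar>l * Z i \<omega>\<bar> \<le> 1 * 1"
        unfolding abs_mult using l bound[OF i] by (intro mult_mono) auto
      from exp_le_quadratic[OF this[simplified]]
      show "exp (l * Z i \<omega>) \<le> 1 + l * Z i \<omega> + l\<^sup>2 * (Z i \<omega>)\<^sup>2" by (simp add: power_mult_distrib)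
    qed
    also have "\<dots> = ennreal (\<integral>\<omega>. 1 + l * Z i \<omega> + l\<^sup>2 * (Z i \<omega>)\<^sup>2 \<partial>M)"
    proof (rule nn_integral_eq_integral)
      show "integrable M (\<lambda>\<omega>. 1 + l * Z i \<omega> + l\<^sup>2 * (Z i \<omega>)\<^sup>2)" using int1 int2 by auto
      show "AE \<omega> in M. 0 \<le> 1 + l * Z i \<omega> + l\<^sup>2 * (Z i \<omega>)\<^sup>2"
      proof (rule AE_I2)
        fix \<omega>
        have "\<bar>l * Z i \<omega>\<bar> \<le> 1 * 1"
          unfolding abs_mult using l bound[OF i] by (intro mult_mono) auto
        then have "0 \<le> 1 + l * Z i \<omega>" by auto
        then show "0 \<le> 1 + l * Z i \<omega> + l\<^sup>2 * (Z i \<omega>)\<^sup>2" by (rule add_nonneg_nonneg) auto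
      qed
    qed
    also have "(\<integral>\<omega>. 1 + l * Z i \<omega> + l\<^sup>2 * (Z i \<omega>)\<^sup>2 \<partial>M) = 1 + l\<^sup>2 * expectation (\<lambda>\<omega>. (Z i \<omega>)\<^sup>2)"
      using int1 int2 mean[OF i] by (simp add: prob_space)
    also have "\<dots> \<le> 1 + l\<^sup>2 * v" using var[OF i] by (intro add_left_mono mult_left_mono) auto
    also have "\<dots> \<le> exp (l\<^sup>2 * v)" by (rule exp_ge_add_one_self)
    finally show ?thesis by (simp add: ennreal_leI)
  qed
  have "emeasure M {\<omega>\<in>space M. s \<le> (\<Sum>i\<in>I. Z i \<omega>)}
      \<le> ennreal (exp (- l * s)) * (\<integral>\<^sup>+\<omega>\<in>space M. exp (l * (\<Sum>i\<in>I. Z i \<omega>)) \<partial>M)"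
    using Chernoff_ineq_nn_integral_ge[OF l(1), of "space M" M "\<lambda>\<omega>. \<Sum>i\<in>I. Z i \<omega>" s] by simp
  also have "(\<integral>\<^sup>+\<omega>\<in>space M. exp (l * (\<Sum>i\<in>I. Z i \<omega>)) \<partial>M)
      = (\<integral>\<^sup>+\<omega>. (\<Prod>i\<in>I. ennreal (exp (l * Z i \<omega>))) \<partial>M)"
    by (intro nn_integral_cong) (simp add: sum_distrib_left exp_sum fin prod_ennreal)
  also have "\<dots> = (\<Prod>i\<in>I. \<integral>\<^sup>+\<omega>. ennreal (exp (l * Z i \<omega>)) \<partial>M)"
    by (intro indep_vars_nn_integral fin indep_vars_compose2[OF ind]) auto
  also have "ennreal (exp (- l * s)) * \<dots> \<le> ennreal (exp (- l * s)) * (\<Prod>i\<in>I. ennreal (exp (l\<^sup>2 * v)))"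
    by (intro mult_left_mono prod_mono_ennreal mgf) auto
  also have "\<dots> = ennreal (exp (- l * s + l\<^sup>2 * (card I * v)))"
    by (simp add: ennreal_mult[symmetric] ennreal_power exp_of_nat_mult[symmetric] mult_exp_exp algebra_simps exp_add)
  finally show ?thesis
    by (subst (asm) emeasure_eq_measure) simp
qed

text \<open>Within one residue class the quotient \<open>i div m\<close> determines i, and it ranges
  over 0 to \<open>n div m\<close>.\<close>

lemma card_residue_class_le:
  fixes m n :: nat and c :: int
  assumes "0 < m"
  shows "card {i\<in>{1..n}. int i mod int m = c} \<le> n div m + 1"
proof -
  have "card {i\<in>{1..n}. int i mod int m = c} \<le> card {0..n div m}"
  proof (rule card_inj_on_le)
    show "inj_on (\<lambda>i. i div m) {i\<in>{1..n}. int i mod int m = c}"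
    proof (rule inj_onI)
      fix i j assume "i \<in> {i\<in>{1..n}. int i mod int m = c}" "j \<in> {i\<in>{1..n}. int i mod int m = c}" "i div m = j div m"
      then have "int (i mod m) = int (j mod m)" "i div m = j div m" by (auto simp: of_nat_mod)
      then show "i = j" by (metis div_mult_mod_eq of_nat_eq_iff)
    qed
  qed (auto intro!: div_le_mono)
  then show ?thesis by simp
qed

text \<open>If the sum over all indices reaches \<open>m * s\<close>, the sum over one of the \<open>m\<close> residue classes
  reaches \<open>s\<close>.\<close>

lemma (in prob_space) bernstein_residue_classes:
  fixes Z :: "int \<Rightarrow> 'a \<Rightarrow> real" and m n :: nat and l s v :: real
  assumes m: "0 < m"
    and ind: "\<And>c. indep_vars (\<lambda>_. borel) Z {i. i mod int m = c}"
    and bound: "\<And>i \<omega>. \<bar>Z i \<omega>\<bar> \<le> 1"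
    and mean: "\<And>i. expectation (Z i) = 0"
    and var: "\<And>i. expectation (\<lambda>\<omega>. (Z i \<omega>)\<^sup>2) \<le> v"
    and l: "0 < l" "l \<le> 1"
  shows "prob {\<omega>\<in>space M. m * s \<le> (\<Sum>i=1..n. Z (int i) \<omega>)}
    \<le> m * exp (- l * s + l\<^sup>2 * ((n div m + 1) * v))"
proof -
  define I where "I c = {i\<in>{1..n}. int i mod int m = int c}" for c :: nat
  have rv[measurable]: "random_variable borel (Z i)" for i
    using ind[of "i mod int m"] by (auto simp: indep_vars_def)
  \<comment> \<open>Nonnegativity of v is what allows the class sizes to be replaced by the common
    bound \<open>n div m + 1\<close>.\<close>
  have v: "0 \<le> v" using var[of 0] by (rule order_trans[rotated]) (simp add: integral_nonneg_AE)
  have split: "(\<Sum>i=1..n. Z (int i) \<omega>) = (\<Sum>c<m. \<Sum>i\<in>I c. Z (int i) \<omega>)" for \<omega>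
  proof -
    have "(\<Sum>c<m. \<Sum>i | i \<in> {1..n} \<and> i mod m = c. Z (int i) \<omega>) = (\<Sum>i=1..n. Z (int i) \<omega>)"
      using m by (intro sum.group) auto
    moreover have "{i. i \<in> {1..n} \<and> i mod m = c} = I c" for c
      by (auto simp: I_def of_nat_mod[symmetric])
    ultimately show ?thesis by simp
  qed
  have "{\<omega>\<in>space M. m * s \<le> (\<Sum>i=1..n. Z (int i) \<omega>)}
      \<subseteq> (\<Union>c<m. {\<omega>\<in>space M. s \<le> (\<Sum>i\<in>I c. Z (int i) \<omega>)})"
  proof (rule subsetI, rule ccontr)
    fix \<omega> assume \<omega>: "\<omega> \<in> {\<omega>\<in>space M. m * s \<le> (\<Sum>i=1..n. Z (int i) \<omega>)}"
      and "\<omega> \<notin> (\<Union>c<m. {\<omega>\<in>space M. s \<le> (\<Sum>i\<in>I c. Z (int i) \<omega>)})"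
    then have "(\<Sum>i\<in>I c. Z (int i) \<omega>) < s" if "c < m" for c using that by force
    then have "(\<Sum>c<m. \<Sum>i\<in>I c. Z (int i) \<omega>) < (\<Sum>c<m. s)"
      using m by (intro sum_strict_mono) auto
    with \<omega> show False unfolding split by simp
  qed
  then have "prob {\<omega>\<in>space M. m * s \<le> (\<Sum>i=1..n. Z (int i) \<omega>)}
      \<le> prob (\<Union>c<m. {\<omega>\<in>space M. s \<le> (\<Sum>i\<in>I c. Z (int i) \<omega>)})"
    by (intro finite_measure_mono) auto
  also have "\<dots> \<le> (\<Sum>c<m. prob {\<omega>\<in>space M. s \<le> (\<Sum>i\<in>I c. Z (int i) \<omega>)})"
    by (intro finite_measure_subadditive_finite) auto
  also have "\<dots> \<le> (\<Sum>c<m. exp (- l * s + l\<^sup>2 * ((n div m + 1) * v)))"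
  proof (rule sum_mono)
    fix c assume "c \<in> {..<m}"
    have "indep_vars (\<lambda>_. borel) Z (int ` I c)"
      by (rule indep_vars_subset[OF ind[of "int c"]]) (auto simp: I_def)
    then have "prob {\<omega>\<in>space M. s \<le> (\<Sum>j\<in>int ` I c. Z j \<omega>)} \<le> exp (- l * s + l\<^sup>2 * (card (int ` I c) * v))"
      by (intro bernstein_indep bound mean var l) (auto simp: I_def)
    then have "prob {\<omega>\<in>space M. s \<le> (\<Sum>i\<in>I c. Z (int i) \<omega>)} \<le> exp (- l * s + l\<^sup>2 * (card (I c) * v))"
      by (simp add: sum.reindex card_image)
    also have "\<dots> \<le> exp (- l * s + l\<^sup>2 * ((n div m + 1) * v))"
    proof -
      have "real (card (I c)) \<le> real (n div m + 1)"
        unfolding I_def using card_residue_class_le[OF m] by (intro of_nat_mono)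
      then show ?thesis using v by (auto intro!: mult_left_mono mult_right_mono)
    qed
    finally show "prob {\<omega>\<in>space M. s \<le> (\<Sum>i\<in>I c. Z (int i) \<omega>)} \<le> exp (- l * s + l\<^sup>2 * ((n div m + 1) * v))" .
  qed
  finally show ?thesis by simp
qed

section \<open>Truncation of the past\<close>

text \<open>The whole process has a product law with equal factors, and reindexing it along the
  injective map from j to i - j gives a product law free of i. This yields stationarity of the
  causal process and one common law for the pasts of both innovation sequences.\<close>

lemma (in prob_space) distr_iid_past:
  assumes "iid_process M S \<epsilon>"
  shows "(\<lambda>\<omega> j. \<epsilon> (i - int j) \<omega>) \<in> M \<rightarrow>\<^sub>M (\<Pi>\<^sub>M j\<in>(UNIV::nat set). S)"
    and "distr M (\<Pi>\<^sub>M j\<in>(UNIV::nat set). S) (\<lambda>\<omega> j. \<epsilon> (i - int j) \<omega>)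
      = (\<Pi>\<^sub>M j\<in>(UNIV::nat set). distr M S (\<epsilon> 0))"
proof -
  have ind: "indep_vars (\<lambda>_. S) \<epsilon> UNIV" and law: "distr M S (\<epsilon> k) = distr M S (\<epsilon> 0)" for k
    using assms by (auto simp: iid_process_def)
  have rv[measurable]: "\<epsilon> k \<in> M \<rightarrow>\<^sub>M S" for k using ind by (auto simp: indep_vars_def)
  show "(\<lambda>\<omega> j. \<epsilon> (i - int j) \<omega>) \<in> M \<rightarrow>\<^sub>M (\<Pi>\<^sub>M j\<in>(UNIV::nat set). S)"
    by (intro measurable_PiM_single') (auto dest: measurable_space[OF rv])
  have meas: "(\<lambda>\<omega> k. \<epsilon> k \<omega>) \<in> M \<rightarrow>\<^sub>M (\<Pi>\<^sub>M k\<in>UNIV. S)"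
    by (intro measurable_PiM_single') (auto dest: measurable_space[OF rv])
  have shift: "(\<lambda>x j. x (i - int j)) \<in> (\<Pi>\<^sub>M k\<in>UNIV. S) \<rightarrow>\<^sub>M (\<Pi>\<^sub>M j\<in>(UNIV::nat set). S)"
    by (intro measurable_PiM_single') (auto simp: space_PiM)
  have "distr M (\<Pi>\<^sub>M k\<in>UNIV. S) (\<lambda>\<omega> k. \<epsilon> k \<omega>) = (\<Pi>\<^sub>M k\<in>UNIV. distr M S (\<epsilon> k))"
    using indep_vars_iff_distr_eq_PiM[where I="UNIV :: int set" and M'="\<lambda>_. S" and X=\<epsilon>] ind
    by (simp add: restrict_UNIV)
  moreover have "(\<lambda>k. distr M S (\<epsilon> k)) = (\<lambda>_. distr M S (\<epsilon> 0))" by (rule ext) (rule law)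
  ultimately have joint: "distr M (\<Pi>\<^sub>M k\<in>UNIV. S) (\<lambda>\<omega> k. \<epsilon> k \<omega>) = (\<Pi>\<^sub>M k\<in>(UNIV::int set). distr M S (\<epsilon> 0))"
    by (simp only:)
  have "distr M (\<Pi>\<^sub>M j\<in>(UNIV::nat set). S) (\<lambda>\<omega> j. \<epsilon> (i - int j) \<omega>)
      = distr (distr M (\<Pi>\<^sub>M k\<in>UNIV. S) (\<lambda>\<omega> k. \<epsilon> k \<omega>)) (\<Pi>\<^sub>M j\<in>(UNIV::nat set). S) (\<lambda>x j. x (i - int j))"
    by (subst distr_distr[OF shift meas]) (simp add: comp_def)
  also have "\<dots> = distr (\<Pi>\<^sub>M k\<in>(UNIV::int set). distr M S (\<epsilon> 0))
      (\<Pi>\<^sub>M j\<in>(UNIV::nat set). distr M S (\<epsilon> 0)) (\<lambda>x j. x (i - int j))"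
    unfolding joint by (intro distr_cong sets_PiM_cong) auto
  also have "\<dots> = (\<Pi>\<^sub>M j\<in>(UNIV::nat set). distr M S (\<epsilon> 0))"
    using distr_PiM_reindex[of "UNIV :: int set" "\<lambda>_. distr M S (\<epsilon> 0)" "\<lambda>j. i - int j" "UNIV :: nat set"]
    by (simp add: prob_space_distr inj_on_def restrict_UNIV)
  finally show "distr M (\<Pi>\<^sub>M j\<in>(UNIV::nat set). S) (\<lambda>\<omega> j. \<epsilon> (i - int j) \<omega>)
      = (\<Pi>\<^sub>M j\<in>(UNIV::nat set). distr M S (\<epsilon> 0))" .
qed

text \<open>The independent past \<open>\<epsilon>'\<close> is frozen at a deterministic tail \<open>z\<close>, chosen by Fubini, so
  that truncated variables at distance at least \<open>m\<close> are independent.\<close>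

lemma (in prob_space) m_dependent_approximation:
  assumes iid: "iid_process M S \<epsilon>" and copy: "independent_copy M S \<epsilon> \<epsilon>'"
    and G[measurable]: "G \<in> borel_measurable (PiM UNIV (\<lambda>_. S))"
    and b: "(\<integral>\<^sup>+ \<omega>. ennreal (\<bar>causal_process G \<epsilon> (int m) \<omega>
        - causal_process G (coupled_innovations \<epsilon> \<epsilon>') (int m) \<omega>\<bar> powr \<alpha>) \<partial>M) \<le> ennreal b"
    and "0 < b"
  shows "\<exists>Y. (\<forall>c. indep_vars (\<lambda>_. borel) Y {i. i mod int m = c}) \<and>
    (\<forall>i. (\<integral>\<^sup>+ \<omega>. ennreal (\<bar>causal_process G \<epsilon> i \<omega> - Y i \<omega>\<bar> powr \<alpha>) \<partial>M) \<le> ennreal (2 * b))"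
proof -
  have ind: "indep_vars (\<lambda>_. S) \<epsilon> UNIV" using iid by (auto simp: iid_process_def)
  have rv[measurable]: "\<epsilon> k \<in> M \<rightarrow>\<^sub>M S" for k using ind by (auto simp: indep_vars_def)
  have iid': "iid_process M S \<epsilon>'" and law': "distr M S (\<epsilon>' 0) = distr M S (\<epsilon> 0)"
    and indep: "indep_var (PiM UNIV (\<lambda>_. S)) (\<lambda>\<omega> k. \<epsilon> k \<omega>) (PiM UNIV (\<lambda>_. S)) (\<lambda>\<omega> k. \<epsilon>' k \<omega>)"
    using copy by (auto simp: independent_copy_def)
  define P where "P = (\<Pi>\<^sub>M j\<in>(UNIV::nat set). S)"
  define D where "D = (\<Pi>\<^sub>M j\<in>(UNIV::nat set). distr M S (\<epsilon> 0))"
  define past where "past e i \<omega> = (\<lambda>j. e (i - int j) \<omega>)" for e :: "int \<Rightarrow> 'a \<Rightarrow> 'b" and i \<omega> and j :: nat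
  define tr where "tr x z = (\<lambda>j. if j < m then x j else z j)" for x z :: "nat \<Rightarrow> 'b"
  have G'[measurable]: "G \<in> borel_measurable P" using G by (simp add: P_def)
  have past_meas[measurable]: "past \<epsilon> i \<in> M \<rightarrow>\<^sub>M P" "past \<epsilon>' i \<in> M \<rightarrow>\<^sub>M P" for i
    using distr_iid_past(1)[OF iid] distr_iid_past(1)[OF iid'] by (auto simp: past_def[abs_def] P_def)
  have past_law: "distr M P (past \<epsilon> i) = D" "distr M P (past \<epsilon>' i) = D" for i
    using distr_iid_past(2)[OF iid] distr_iid_past(2)[OF iid']
    by (auto simp: past_def[abs_def] P_def D_def law')
  have sets_D[measurable_cong]: "sets D = sets P"
    unfolding D_def P_def by (intro sets_PiM_cong) auto
  interpret D: prob_space D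
    unfolding D_def by (intro prob_space_PiM prob_space_distr) auto
  have tr_meas[measurable]: "(\<lambda>p. tr (fst p) (snd p)) \<in> P \<Otimes>\<^sub>M P \<rightarrow>\<^sub>M P"
    unfolding tr_def P_def
    by (intro measurable_PiM_single') (auto simp: space_PiM space_pair_measure PiE_iff)
  define h where "h x z = ennreal (\<bar>G x - G (tr x z)\<bar> powr \<alpha>)" for x z
  have h_meas[measurable]: "(\<lambda>p. h (fst p) (snd p)) \<in> borel_measurable (P \<Otimes>\<^sub>M P)"
    unfolding h_def using measurable_compose[OF tr_meas G'] by simp
  have h_meas1: "(\<lambda>x. h x z) \<in> borel_measurable P" if "z \<in> space P" for z
    using measurable_compose[OF measurable_Pair1'[OF that] h_meas] measurable_compose[OF measurable_Pair2'[OF that] h_meas]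
    by simp
  have shift: "(\<lambda>x j. x (int m - int j)) \<in> (\<Pi>\<^sub>M k\<in>UNIV. S) \<rightarrow>\<^sub>M P"
    unfolding P_def by (intro measurable_PiM_single') (auto simp: space_PiM)
  \<comment> \<open>Read at time m, the two pasts are independent with the same law D, so the
    contraction bound becomes an integral over the square of D, ready for Fubini.\<close>
  have "indep_var P (past \<epsilon> (int m)) P (past \<epsilon>' (int m))"
    using indep_var_compose[OF indep shift shift] by (simp add: comp_def past_def[abs_def])
  then have joint: "distr M (P \<Otimes>\<^sub>M P) (\<lambda>\<omega>. (past \<epsilon> (int m) \<omega>, past \<epsilon>' (int m) \<omega>)) = D \<Otimes>\<^sub>M D"
    by (simp add: indep_var_distribution_eq past_law)
  have X: "causal_process G \<epsilon> i \<omega> = G (past \<epsilon> i \<omega>)" for i \<omega>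
    by (simp add: causal_process_def past_def)
  \<comment> \<open>The time m - j is at most 0 exactly when the lag j is at least m, so the
    coupling at time m replaces precisely the lags that \<open>tr\<close> takes from its second
    argument.\<close>
  have "past (coupled_innovations \<epsilon> \<epsilon>') (int m) \<omega> = tr (past \<epsilon> (int m) \<omega>) (past \<epsilon>' (int m) \<omega>)" for \<omega>
    by (auto simp: past_def coupled_innovations_def tr_def)
  then have "causal_process G (coupled_innovations \<epsilon> \<epsilon>') (int m) \<omega>
      = G (tr (past \<epsilon> (int m) \<omega>) (past \<epsilon>' (int m) \<omega>))" for \<omega>
    unfolding causal_process_def by (simp add: past_def[symmetric])
  then have "(\<integral>\<^sup>+ \<omega>. h (past \<epsilon> (int m) \<omega>) (past \<epsilon>' (int m) \<omega>) \<partial>M) \<le> ennreal b"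
    using b by (simp add: h_def X)
  also have "(\<integral>\<^sup>+ \<omega>. h (past \<epsilon> (int m) \<omega>) (past \<epsilon>' (int m) \<omega>) \<partial>M) = (\<integral>\<^sup>+ p. h (fst p) (snd p) \<partial>(D \<Otimes>\<^sub>M D))"
    unfolding joint[symmetric] by (subst nn_integral_distr) auto
  also have "\<dots> = (\<integral>\<^sup>+ z. (\<integral>\<^sup>+ x. h x z \<partial>D) \<partial>D)"
  proof -
    interpret pair_sigma_finite D D by unfold_locales
    have "(\<lambda>p. h (fst p) (snd p)) \<in> borel_measurable (D \<Otimes>\<^sub>M D)" by measurable
    from nn_integral_snd[OF this] show ?thesis by simp
  qed
  finally have int_le: "(\<integral>\<^sup>+ z. (\<integral>\<^sup>+ x. h x z \<partial>D) \<partial>D) \<le> ennreal b" .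
  \<comment> \<open>If every tail were worse than 2 b, the average over z would be at least 2 b; the
    factor 2 makes this a strict contradiction because b is positive.\<close>
  have "\<exists>z\<in>space P. (\<integral>\<^sup>+ x. h x z \<partial>D) \<le> ennreal (2 * b)"
  proof (rule ccontr)
    assume "\<not> ?thesis"
    then have "ennreal (2 * b) \<le> (\<integral>\<^sup>+ x. h x z \<partial>D)" if "z \<in> space D" for z
      using that sets_eq_imp_space_eq[OF sets_D] by (auto simp: not_le intro: less_imp_le)
    then have "(\<integral>\<^sup>+ z. ennreal (2 * b) \<partial>D) \<le> (\<integral>\<^sup>+ z. (\<integral>\<^sup>+ x. h x z \<partial>D) \<partial>D)"
      by (rule nn_integral_mono)
    then have "ennreal (2 * b) \<le> ennreal b"
      using int_le by (simp add: D.emeasure_space_1)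
    then show False using \<open>0 < b\<close> by (simp add: ennreal_le_iff)
  qed
  then obtain z where z: "z \<in> space P" and hz: "(\<integral>\<^sup>+ x. h x z \<partial>D) \<le> ennreal (2 * b)" by auto
  define Y where "Y i \<omega> = G (tr (past \<epsilon> i \<omega>) z)" for i \<omega>
  \<comment> \<open>The law of \<open>past \<epsilon> i\<close> is D for every i, so the single tail
    z serves all times at once.\<close>
  have "(\<integral>\<^sup>+ \<omega>. ennreal (\<bar>causal_process G \<epsilon> i \<omega> - Y i \<omega>\<bar> powr \<alpha>) \<partial>M) \<le> ennreal (2 * b)" for i
  proof -
    have "(\<integral>\<^sup>+ \<omega>. ennreal (\<bar>causal_process G \<epsilon> i \<omega> - Y i \<omega>\<bar> powr \<alpha>) \<partial>M)
        = (\<integral>\<^sup>+ \<omega>. h (past \<epsilon> i \<omega>) z \<partial>M)"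
      by (simp add: X Y_def h_def)
    also have "\<dots> = (\<integral>\<^sup>+ x. h x z \<partial>D)"
      unfolding past_law(1)[of i, symmetric] using h_meas1[OF z] by (subst nn_integral_distr) auto
    finally show ?thesis using hz by simp
  qed
  moreover have "indep_vars (\<lambda>_. borel) Y {i. i mod int m = c}" for c
  proof -
    \<comment> \<open>\<open>Y i\<close> depends only on the innovations with times in this window
      of length m. Distinct members of a residue class are at least m apart, so their windows are
      disjoint.\<close>
    define K where "K i = {i - int m <.. i}" for i
    define g where "g i x = G (tr (\<lambda>j. x (i - int j)) z)" for i and x :: "int \<Rightarrow> 'b"
    have disj: "disjoint_family_on K {i. i mod int m = c}"
    proof (unfold disjoint_family_on_def, intro ballI impI)
      fix i j assume ij: "i \<in> {i. i mod int m = c}" "j \<in> {i. i mod int m = c}" "i \<noteq> j"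
      then have "i mod int m = j mod int m" by simp
      then have "int m dvd i - j" by (simp add: mod_eq_dvd_iff)
      then have "int m \<le> \<bar>i - j\<bar>" using dvd_imp_le_int[of "i - j" "int m"] ij(3) by simp
      then show "K i \<inter> K j = {}" by (auto simp: K_def)
    qed
    have blocks: "indep_vars (\<lambda>i. PiM (K i) (\<lambda>_. S)) (\<lambda>i \<omega>. restrict (\<lambda>k. \<epsilon> k \<omega>) (K i)) {i. i mod int m = c}"
      by (rule indep_vars_restrict[OF ind _ disj]) auto
    have g_meas: "g i \<in> borel_measurable (PiM (K i) (\<lambda>_. S))" for i
    proof -
      have "(\<lambda>x. tr (\<lambda>j. x (i - int j)) z) \<in> PiM (K i) (\<lambda>_. S) \<rightarrow>\<^sub>M P"
        unfolding P_def tr_def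
      proof (intro measurable_PiM_single')
        fix j :: nat
        have zj: "z j \<in> space S" using z by (auto simp: P_def space_PiM PiE_iff)
        show "(\<lambda>x. if j < m then x (i - int j) else z j) \<in> PiM (K i) (\<lambda>_. S) \<rightarrow>\<^sub>M S"
        proof (cases "j < m")
          case True
          then have "i - int j \<in> K i" by (simp add: K_def)
          then show ?thesis using True by (simp add: measurable_component_singleton)
        next
          case False
          then show ?thesis using zj by simp
        qed
      next
        show "(\<lambda>x j. if j < m then x (i - int j) else z j)
            \<in> space (PiM (K i) (\<lambda>_. S)) \<rightarrow> (\<Pi>\<^sub>E j\<in>UNIV. space S)"
          using z by (auto simp: K_def P_def space_PiM PiE_iff)
      qed
      then show ?thesis unfolding g_def using G' by (rule measurable_compose)
    qed
    have "indep_vars (\<lambda>_. borel) (\<lambda>i \<omega>. g i (restrict (\<lambda>k. \<epsilon> k \<omega>) (K i))) {i. i mod int m = c}"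
      using indep_vars_compose2[OF blocks, of g "\<lambda>_. borel", OF g_meas] .
    moreover have "g i (restrict (\<lambda>k. \<epsilon> k \<omega>) (K i)) = Y i \<omega>" for i \<omega>
    proof -
      have "tr (\<lambda>j. restrict (\<lambda>k. \<epsilon> k \<omega>) (K i) (i - int j)) z = tr (past \<epsilon> i \<omega>) z"
        by (rule ext) (simp add: tr_def past_def K_def)
      then show ?thesis by (simp only: g_def Y_def)
    qed
    ultimately show ?thesis by (simp only:)
  qed
  ultimately show ?thesis by (intro exI[of _ Y] conjI allI)
qed

text \<open>Both \<open>(a, b]\<close> and \<open>(-\<infinity>, b]\<close>, according to the flag.\<close>

definition ray :: "bool \<Rightarrow> real \<Rightarrow> real \<Rightarrow> real set" where
  "ray s a b = {x. (s \<longrightarrow> a < x) \<and> x \<le> b}"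

lemma ray_measurable[measurable, simp]: "ray s a b \<in> sets borel"
  by (cases s) (simp_all add: ray_def)

lemma ray_enlarge: "x \<in> ray s a b \<Longrightarrow> \<bar>x - y\<bar> \<le> d \<Longrightarrow> y \<in> ray s (a - d) (b + d)"
  by (auto simp: ray_def)

text \<open>Enlarging adds at most two intervals of length d. No order between a and b is assumed,
  so the bound also applies when the smaller ray has been shrunk to the empty set.\<close>

lemma (in prob_space) prob_ray_enlarge_le:
  fixes X :: "'a \<Rightarrow> real"
  assumes [measurable]: "random_variable borel X"
    and L: "\<And>u v. u \<le> v \<Longrightarrow> prob {\<omega>\<in>space M. u < X \<omega> \<and> X \<omega> \<le> v} \<le> L * (v - u)"
    and "0 \<le> d"
  shows "prob {\<omega>\<in>space M. X \<omega> \<in> ray s (a - d) (b + d)} \<le> prob {\<omega>\<in>space M. X \<omega> \<in> ray s a b} + 2 * L * d"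
proof -
  have "prob {\<omega>\<in>space M. X \<omega> \<in> ray s (a - d) (b + d)}
      \<le> prob ({\<omega>\<in>space M. X \<omega> \<in> ray s a b} \<union> ({\<omega>\<in>space M. a - d < X \<omega> \<and> X \<omega> \<le> a} \<union> {\<omega>\<in>space M. b < X \<omega> \<and> X \<omega> \<le> b + d}))"
    by (intro finite_measure_mono) (auto simp: ray_def)
  also have "\<dots> \<le> prob {\<omega>\<in>space M. X \<omega> \<in> ray s a b} + (prob {\<omega>\<in>space M. a - d < X \<omega> \<and> X \<omega> \<le> a} + prob {\<omega>\<in>space M. b < X \<omega> \<and> X \<omega> \<le> b + d})"
    by (intro order_trans[OF measure_Un_le] add_left_mono measure_Un_le) auto
  also have "\<dots> \<le> prob {\<omega>\<in>space M. X \<omega> \<in> ray s a b} + 2 * L * d"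
    using L[of "a - d" a] L[of b "b + d"] \<open>0 \<le> d\<close> by simp
  finally show ?thesis .
qed

section \<open>Deviation of counts: from the truncated variables back to the process\<close>

lemma (in prob_space) m_dependent_count_deviation:
  fixes Y :: "int \<Rightarrow> 'a \<Rightarrow> real" and m n :: nat and l s q \<sigma> :: real
  assumes m: "0 < m"
    and ind: "\<And>c. indep_vars (\<lambda>_. borel) Y {i. i mod int m = c}"
    and A[measurable]: "A \<in> sets borel"
    and q: "\<And>i. prob {\<omega>\<in>space M. Y i \<omega> \<in> A} \<le> q"
    and l: "0 < l" "l \<le> 1" and \<sigma>: "\<sigma> \<in> {1, -1}"
  shows "prob {\<omega>\<in>space M. m * s \<le> \<sigma> * ((\<Sum>i=1..n. indicator A (Y (int i) \<omega>))
      - (\<Sum>i=1..n. prob {\<omega>\<in>space M. Y (int i) \<omega> \<in> A}))}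
    \<le> m * exp (- l * s + l\<^sup>2 * ((n div m + 1) * q))"
proof -
  have rv[measurable]: "random_variable borel (Y i)" for i
    using ind[of "i mod int m"] by (auto simp: indep_vars_def)
  define p where "p i = prob {\<omega>\<in>space M. Y i \<omega> \<in> A}" for i
  \<comment> \<open>Centring is at the individual probabilities, as no common law is assumed for the
    \<open>Y i\<close>. The sign \<sigma> lets one argument serve both tails, and the variance p (1
    - p) is at most q.\<close>
  define Z where "Z i \<omega> = \<sigma> * (indicator A (Y i \<omega>) - p i)" for i \<omega>
  have p01: "0 \<le> p i" "p i \<le> 1" for i by (auto simp: p_def)
  have Eind: "expectation (\<lambda>\<omega>. indicator A (Y i \<omega>)) = p i" for i
  proof -
    have "expectation (\<lambda>\<omega>. indicator A (Y i \<omega>)) = expectation (indicat_real {\<omega>\<in>space M. Y i \<omega> \<in> A})"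
      by (rule Bochner_Integration.integral_cong) (auto simp: indicator_def)
    also have "\<dots> = prob ({\<omega>\<in>space M. Y i \<omega> \<in> A} \<inter> space M)"
      by (rule Bochner_Integration.integral_indicator)
    also have "{\<omega>\<in>space M. Y i \<omega> \<in> A} \<inter> space M = {\<omega>\<in>space M. Y i \<omega> \<in> A}" by blast
    also have "prob \<dots> = p i" by (simp only: p_def)
    finally show ?thesis .
  qed
  have int: "integrable M (\<lambda>\<omega>. indicator A (Y i \<omega>) :: real)" for i
    by (intro integrable_const_bound[where B=1]) (auto simp: indicator_def)
  have "prob {\<omega>\<in>space M. m * s \<le> (\<Sum>i=1..n. Z (int i) \<omega>)}
    \<le> m * exp (- l * s + l\<^sup>2 * ((n div m + 1) * q))"
  proof (rule bernstein_residue_classes[OF m])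
    show "indep_vars (\<lambda>_. borel) Z {i. i mod int m = c}" for c
      unfolding Z_def by (rule indep_vars_compose2[OF ind]) auto
    show "\<bar>Z i \<omega>\<bar> \<le> 1" for i \<omega>
      using \<sigma> p01[of i] by (auto simp: Z_def indicator_def abs_mult)
    show "expectation (Z i) = 0" for i
      unfolding Z_def using int[of i] by (simp add: Eind prob_space)
    show "expectation (\<lambda>\<omega>. (Z i \<omega>)\<^sup>2) \<le> q" for i
    proof -
      have "(Z i \<omega>)\<^sup>2 = (1 - 2 * p i) * indicator A (Y i \<omega>) + (p i)\<^sup>2" for \<omega>
        using \<sigma> by (auto simp: Z_def indicator_def power2_eq_square algebra_simps)
      then have "expectation (\<lambda>\<omega>. (Z i \<omega>)\<^sup>2) = (1 - 2 * p i) * p i + (p i)\<^sup>2"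
        using int[of i] by (simp add: Eind prob_space)
      also have "\<dots> \<le> p i" by (simp add: power2_eq_square algebra_simps)
      finally show ?thesis using q[of i] by (simp add: p_def)
    qed
  qed (use l in auto)
  moreover have "(\<Sum>i=1..n. Z (int i) \<omega>) = \<sigma> * ((\<Sum>i=1..n. indicator A (Y (int i) \<omega>)) - (\<Sum>i=1..n. p (int i)))" for \<omega>
    by (simp add: Z_def sum_subtractf sum_distrib_left right_diff_distrib)
  ultimately show ?thesis by (simp add: p_def)
qed

text \<open>Unless some X i with i \<le> n is further than \<delta> from Y i, an event of
  probability at most n \<eta>, the count of X in a ray lies between the counts of Y in the ray
  shrunk and enlarged by \<delta>. The two exponential terms are the lower tail of the former and
  the upper tail of the latter. Comparing the probabilities of Y with that of X moves the ends by
  another \<delta>, hence by 2 \<delta> in all; two ends at density L give the bias 4 L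
  \<delta>.\<close>

lemma (in prob_space) count_deviation_of_approximation:
  fixes X Y :: "int \<Rightarrow> 'a \<Rightarrow> real" and m n :: nat and l s q L \<delta> \<eta> a b :: real
  assumes rvX[measurable]: "\<And>i. random_variable borel (X i)"
    and law: "\<And>i. distr M borel (X i) = distr M borel (X 0)"
    and L: "\<And>u v. u \<le> v \<Longrightarrow> prob {\<omega>\<in>space M. u < X 0 \<omega> \<and> X 0 \<omega> \<le> v} \<le> L * (v - u)"
    and m: "0 < m"
    and ind: "\<And>c. indep_vars (\<lambda>_. borel) Y {i. i mod int m = c}"
    and close: "\<And>i. prob {\<omega>\<in>space M. \<delta> < \<bar>X i \<omega> - Y i \<omega>\<bar>} \<le> \<eta>"
    and \<delta>: "0 \<le> \<delta>"
    and q: "prob {\<omega>\<in>space M. X 0 \<omega> \<in> ray \<tau> a b} + (4 * L * \<delta> + \<eta>) \<le> q"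
    and l: "0 < l" "l \<le> 1"
  shows "prob {\<omega>\<in>space M. m * s + n * (4 * L * \<delta> + \<eta>)
        < \<bar>(\<Sum>i=1..n. indicator (ray \<tau> a b) (X (int i) \<omega>)) - n * prob {\<omega>\<in>space M. X 0 \<omega> \<in> ray \<tau> a b}\<bar>}
    \<le> n * \<eta> + 2 * (m * exp (- l * s + l\<^sup>2 * ((n div m + 1) * q)))"
proof -
  have rvY[measurable]: "random_variable borel (Y i)" for i
    using ind[of "i mod int m"] by (auto simp: indep_vars_def)
  have probX: "prob {\<omega>\<in>space M. X i \<omega> \<in> A} = prob {\<omega>\<in>space M. X 0 \<omega> \<in> A}"
    if [measurable]: "A \<in> sets borel" for A i
  proof -
    have "prob {\<omega>\<in>space M. X j \<omega> \<in> A} = measure (distr M borel (X j)) A" for j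
      by (subst measure_distr) (auto intro!: arg_cong[where f=prob])
    then show ?thesis by (simp add: law[of i])
  qed
  have L0: "0 \<le> L"
    using order_trans[OF measure_nonneg L[of 0 1]] by simp
  have \<eta>0: "0 \<le> \<eta>" using order_trans[OF measure_nonneg close[of 0]] by simp
  \<comment> \<open>Stated for arbitrary U and V because it is applied both from X to Y and from Y
    to X.\<close>
  have transfer: "prob {\<omega>\<in>space M. U \<omega> \<in> ray \<tau> a b}
      \<le> prob {\<omega>\<in>space M. V \<omega> \<in> ray \<tau> (a - \<delta>) (b + \<delta>)} + \<eta>"
    if [measurable]: "random_variable borel U" "random_variable borel V"
      and "prob {\<omega>\<in>space M. \<delta> < \<bar>U \<omega> - V \<omega>\<bar>} \<le> \<eta>" for U V :: "'a \<Rightarrow> real" and a b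
  proof -
    have "prob {\<omega>\<in>space M. U \<omega> \<in> ray \<tau> a b}
        \<le> prob ({\<omega>\<in>space M. V \<omega> \<in> ray \<tau> (a - \<delta>) (b + \<delta>)} \<union> {\<omega>\<in>space M. \<delta> < \<bar>U \<omega> - V \<omega>\<bar>})"
      by (intro finite_measure_mono) (auto simp: not_less intro: ray_enlarge)
    also have "\<dots> \<le> prob {\<omega>\<in>space M. V \<omega> \<in> ray \<tau> (a - \<delta>) (b + \<delta>)} + prob {\<omega>\<in>space M. \<delta> < \<bar>U \<omega> - V \<omega>\<bar>}"
      by (intro measure_Un_le) auto
    finally show ?thesis using that by simp
  qed
  have close': "prob {\<omega>\<in>space M. \<delta> < \<bar>Y i \<omega> - X i \<omega>\<bar>} \<le> \<eta>" for i
    using close[of i] by (simp add: abs_minus_commute)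
  define J where "J = ray \<tau> a b"
  define J1 where "J1 = ray \<tau> (a + \<delta>) (b - \<delta>)"
  define J2 where "J2 = ray \<tau> (a - \<delta>) (b + \<delta>)"
  have [measurable]: "J \<in> sets borel" "J1 \<in> sets borel" "J2 \<in> sets borel"
    by (simp_all add: J_def J1_def J2_def)
  define p where "p = prob {\<omega>\<in>space M. X 0 \<omega> \<in> J}"
  define P where "P A i = prob {\<omega>\<in>space M. Y (int i) \<omega> \<in> A}" for A i
  define S where "S A Z \<omega> = (\<Sum>i=1..n. indicator A (Z (int i) \<omega>) :: real)" for A and Z :: "int \<Rightarrow> 'a \<Rightarrow> real" and \<omega>
  have P1_le: "prob {\<omega>\<in>space M. Y i \<omega> \<in> J1} \<le> p + \<eta>" for i
    using transfer[OF rvY rvX close'[of i], of "a + \<delta>" "b - \<delta>"] probX[of J i]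
    by (simp add: J1_def J_def p_def)
  have P1_ge: "p - (4 * L * \<delta> + \<eta>) \<le> prob {\<omega>\<in>space M. Y i \<omega> \<in> J1}" for i
  proof -
    \<comment> \<open>The shrinking is by 2 \<delta> since the transfer to Y enlarges by \<delta>
      again and has to end in \<open>J1\<close>.\<close>
    have "p \<le> prob {\<omega>\<in>space M. X 0 \<omega> \<in> ray \<tau> (a + 2 * \<delta>) (b - 2 * \<delta>)} + 4 * L * \<delta>"
      using prob_ray_enlarge_le[OF rvX[of 0] L, of "2 * \<delta>" \<tau> "a + 2 * \<delta>" "b - 2 * \<delta>"] \<delta>
      by (simp add: p_def J_def)
    also have "prob {\<omega>\<in>space M. X 0 \<omega> \<in> ray \<tau> (a + 2 * \<delta>) (b - 2 * \<delta>)} \<le> prob {\<omega>\<in>space M. Y i \<omega> \<in> J1} + \<eta>"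
      using transfer[OF rvX rvY close[of i], of "a + 2 * \<delta>" "b - 2 * \<delta>"] probX[of "ray \<tau> (a + 2 * \<delta>) (b - 2 * \<delta>)" i]
      by (simp add: J1_def algebra_simps)
    finally show ?thesis by simp
  qed
  have P2_le: "prob {\<omega>\<in>space M. Y i \<omega> \<in> J2} \<le> p + (4 * L * \<delta> + \<eta>)" for i
  proof -
    have "prob {\<omega>\<in>space M. Y i \<omega> \<in> J2} \<le> prob {\<omega>\<in>space M. X 0 \<omega> \<in> ray \<tau> (a - 2 * \<delta>) (b + 2 * \<delta>)} + \<eta>"
      using transfer[OF rvY rvX close'[of i], of "a - \<delta>" "b + \<delta>"] probX[of "ray \<tau> (a - 2 * \<delta>) (b + 2 * \<delta>)" i]
      by (simp add: J2_def algebra_simps)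
    also have "prob {\<omega>\<in>space M. X 0 \<omega> \<in> ray \<tau> (a - 2 * \<delta>) (b + 2 * \<delta>)} \<le> p + 4 * L * \<delta>"
      using prob_ray_enlarge_le[OF rvX[of 0] L, of "2 * \<delta>" \<tau> a b] \<delta>
      by (simp add: p_def J_def)
    finally show ?thesis by simp
  qed
  have L\<delta>: "0 \<le> 4 * L * \<delta>" using L0 \<delta> by simp
  have q': "p + (4 * L * \<delta> + \<eta>) \<le> q" using q by (simp add: p_def J_def)
  define E0 where "E0 = (\<Union>i\<in>{1..n}. {\<omega>\<in>space M. \<delta> < \<bar>X (int i) \<omega> - Y (int i) \<omega>\<bar>})"
  define E1 where "E1 = {\<omega>\<in>space M. m * s \<le> -1 * (S J1 Y \<omega> - (\<Sum>i=1..n. P J1 i))}"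
  define E2 where "E2 = {\<omega>\<in>space M. m * s \<le> 1 * (S J2 Y \<omega> - (\<Sum>i=1..n. P J2 i))}"
  have [measurable]: "E0 \<in> events" "E1 \<in> events" "E2 \<in> events"
    unfolding E0_def E1_def E2_def S_def by measurable
  have "{\<omega>\<in>space M. m * s + n * (4 * L * \<delta> + \<eta>) < \<bar>S J X \<omega> - n * p\<bar>} \<subseteq> E0 \<union> (E1 \<union> E2)"
  proof (rule subsetI, rule ccontr)
    fix \<omega> assume "\<omega> \<in> {\<omega>\<in>space M. m * s + n * (4 * L * \<delta> + \<eta>) < \<bar>S J X \<omega> - n * p\<bar>}"
      and "\<omega> \<notin> E0 \<union> (E1 \<union> E2)"
    then have \<omega>: "\<omega> \<in> space M" "m * s + n * (4 * L * \<delta> + \<eta>) < \<bar>S J X \<omega> - n * p\<bar>"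
      "\<omega> \<notin> E0" "\<omega> \<notin> E1" "\<omega> \<notin> E2" by auto
    have c: "\<bar>X (int i) \<omega> - Y (int i) \<omega>\<bar> \<le> \<delta>" if "i \<in> {1..n}" for i
      using \<omega> that by (force simp: E0_def not_less)
    have "S J X \<omega> \<le> S J2 Y \<omega>"
      unfolding S_def
    proof (rule sum_mono)
      fix i assume "i \<in> {1..n}"
      from c[OF this] show "indicator J (X (int i) \<omega>) \<le> (indicator J2 (Y (int i) \<omega>) :: real)"
        using ray_enlarge[of "X (int i) \<omega>" \<tau> a b "Y (int i) \<omega>" \<delta>] by (auto simp: J_def J2_def indicator_def)
    qed
    moreover have "S J2 Y \<omega> < m * s + (\<Sum>i=1..n. P J2 i)" using \<omega> by (auto simp: E2_def not_le)
    moreover have "(\<Sum>i=1..n. P J2 i) \<le> (\<Sum>i=1..n. p + (4 * L * \<delta> + \<eta>))"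
      unfolding P_def by (intro sum_mono P2_le)
    ultimately have up: "S J X \<omega> - n * p < m * s + n * (4 * L * \<delta> + \<eta>)" by (simp add: algebra_simps)
    have "S J1 Y \<omega> \<le> S J X \<omega>"
      unfolding S_def
    proof (rule sum_mono)
      fix i assume "i \<in> {1..n}"
      from c[OF this] show "indicator J1 (Y (int i) \<omega>) \<le> (indicator J (X (int i) \<omega>) :: real)"
        using ray_enlarge[of "Y (int i) \<omega>" \<tau> "a + \<delta>" "b - \<delta>" "X (int i) \<omega>" \<delta>]
        by (auto simp: J_def J1_def indicator_def abs_minus_commute)
    qed
    moreover have "(\<Sum>i=1..n. P J1 i) - m * s < S J1 Y \<omega>" using \<omega> by (auto simp: E1_def not_le)
    moreover have "(\<Sum>i=1..n. p - (4 * L * \<delta> + \<eta>)) \<le> (\<Sum>i=1..n. P J1 i)"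
      unfolding P_def by (intro sum_mono P1_ge)
    ultimately have "- (m * s + n * (4 * L * \<delta> + \<eta>)) < S J X \<omega> - n * p" by (simp add: algebra_simps)
    with up \<omega> show False by linarith
  qed
  then have "prob {\<omega>\<in>space M. m * s + n * (4 * L * \<delta> + \<eta>) < \<bar>S J X \<omega> - n * p\<bar>} \<le> prob (E0 \<union> (E1 \<union> E2))"
    by (intro finite_measure_mono) auto
  also have "\<dots> \<le> prob E0 + (prob E1 + prob E2)"
    by (intro order_trans[OF measure_Un_le] add_left_mono measure_Un_le) auto
  also have "prob E0 \<le> (\<Sum>i\<in>{1..n}. prob {\<omega>\<in>space M. \<delta> < \<bar>X (int i) \<omega> - Y (int i) \<omega>\<bar>})"
    unfolding E0_def by (intro finite_measure_subadditive_finite) auto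
  also have "\<dots> \<le> (\<Sum>i\<in>{1..n}. \<eta>)" by (intro sum_mono close)
  also have "prob E1 \<le> m * exp (- l * s + l\<^sup>2 * ((n div m + 1) * q))"
    unfolding E1_def S_def P_def using P1_le q' L\<delta> \<eta>0 l
    by (intro m_dependent_count_deviation m ind) (auto intro: order_trans[OF P1_le])
  also have "prob E2 \<le> m * exp (- l * s + l\<^sup>2 * ((n div m + 1) * q))"
    unfolding E2_def S_def P_def using l
    by (intro m_dependent_count_deviation m ind order_trans[OF P2_le q']) auto
  finally show ?thesis by (simp add: S_def J_def p_def)
qed

lemma (in prob_space) prob_gt_le_moment:
  fixes Z :: "'a \<Rightarrow> real"
  assumes [measurable]: "random_variable borel Z"
    and b: "(\<integral>\<^sup>+ \<omega>. ennreal (\<bar>Z \<omega>\<bar> powr \<alpha>) \<partial>M) \<le> ennreal b"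
    and "0 < \<alpha>" "0 < d" "0 \<le> b"
  shows "prob {\<omega>\<in>space M. d < \<bar>Z \<omega>\<bar>} \<le> d powr (- \<alpha>) * b"
proof -
  have "emeasure M {\<omega>\<in>space M. d < \<bar>Z \<omega>\<bar>}
      \<le> emeasure M {\<omega>\<in>space M. 1 \<le> ennreal (d powr (- \<alpha>)) * ennreal (\<bar>Z \<omega>\<bar> powr \<alpha>)}"
  proof (intro emeasure_mono subsetI CollectI conjI)
    fix \<omega> assume "\<omega> \<in> {\<omega>\<in>space M. d < \<bar>Z \<omega>\<bar>}"
    then have w: "\<omega> \<in> space M" "d < \<bar>Z \<omega>\<bar>" by auto
    have "d powr (- \<alpha>) * d powr \<alpha> \<le> d powr (- \<alpha>) * \<bar>Z \<omega>\<bar> powr \<alpha>"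
      using w \<open>0 < \<alpha>\<close> \<open>0 < d\<close> by (intro mult_left_mono powr_mono2) auto
    then show "1 \<le> ennreal (d powr (- \<alpha>)) * ennreal (\<bar>Z \<omega>\<bar> powr \<alpha>)"
      using \<open>0 < d\<close> by (simp add: ennreal_mult[symmetric] powr_add[symmetric])
  qed auto
  also have "\<dots> \<le> ennreal (d powr (- \<alpha>)) * (\<integral>\<^sup>+ \<omega>. ennreal (\<bar>Z \<omega>\<bar> powr \<alpha>) * indicator (space M) \<omega> \<partial>M)"
    by (rule nn_integral_Markov_inequality) auto
  also have "(\<integral>\<^sup>+ \<omega>. ennreal (\<bar>Z \<omega>\<bar> powr \<alpha>) * indicator (space M) \<omega> \<partial>M) = (\<integral>\<^sup>+ \<omega>. ennreal (\<bar>Z \<omega>\<bar> powr \<alpha>) \<partial>M)"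
    by (intro nn_integral_cong) auto
  also have "ennreal (d powr (- \<alpha>)) * \<dots> \<le> ennreal (d powr (- \<alpha>)) * ennreal b"
    by (intro mult_left_mono b) auto
  also have "\<dots> = ennreal (d powr (- \<alpha>) * b)" using \<open>0 \<le> b\<close> by (simp add: ennreal_mult)
  finally show ?thesis using \<open>0 \<le> b\<close> by (subst (asm) emeasure_eq_measure) simp
qed

text \<open>Blocks of length \<open>m \<approx> c ln n\<close> make the truncation error polynomially small; they cost a
  factor \<open>sqrt (ln n)\<close> in the deviation bound.\<close>

lemma (in prob_space) count_concentration:
  fixes X :: "int \<Rightarrow> 'a \<Rightarrow> real" and L \<alpha> B r \<kappa> :: real
  assumes rvX[measurable]: "\<And>i. random_variable borel (X i)"
    and law: "\<And>i. distr M borel (X i) = distr M borel (X 0)"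
    and L: "\<And>u v. u \<le> v \<Longrightarrow> prob {\<omega>\<in>space M. u < X 0 \<omega> \<and> X 0 \<omega> \<le> v} \<le> L * (v - u)"
    and par: "0 < \<alpha>" "0 < B" "0 < r" "r < 1" "0 \<le> \<kappa>"
    and approx: "\<And>m. \<exists>Y. (\<forall>c. indep_vars (\<lambda>_. borel) Y {i. i mod int m = c}) \<and>
      (\<forall>i. (\<integral>\<^sup>+ \<omega>. ennreal (\<bar>X i \<omega> - Y i \<omega>\<bar> powr \<alpha>) \<partial>M) \<le> ennreal (B * r ^ m))"
  shows "\<exists>K>0. \<forall>\<^sub>F n in sequentially. \<forall>(Q::real) \<tau> (a::real) (b::real). real n powr (- 1 / 2) \<le> Q \<longrightarrow>
    prob {\<omega>\<in>space M. X 0 \<omega> \<in> ray \<tau> a b} \<le> Q \<longrightarrow>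
    prob {\<omega>\<in>space M. K * sqrt (n * Q) * ln n
        < \<bar>(\<Sum>i=1..n. indicator (ray \<tau> a b) (X (int i) \<omega>)) - n * prob {\<omega>\<in>space M. X 0 \<omega> \<in> ray \<tau> a b}\<bar>}
      \<le> real n powr (- \<kappa>)"
proof -
  \<comment> \<open>This makes r^m at most n^-(\<kappa> + 4 + 2 \<alpha>): Markov's inequality at
    level n^-2 loses n^(2 \<alpha>), one factor n absorbs B, and n^-(\<kappa> + 3) remains for each
    index.\<close>
  define c where "c = (\<kappa> + 4 + 2 * \<alpha>) / (- ln r)"
  have lnr: "ln r < 0" using par by simp
  have c: "0 < c" unfolding c_def using par lnr by (intro divide_pos_pos) auto
  have L0: "0 \<le> L"
    using order_trans[OF measure_nonneg L[of 0 1]] by simp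
  \<comment> \<open>The first summand pays for m s, the second for n times the bias of the
    truncation.\<close>
  define K where "K = (\<kappa> + 4) * sqrt (8 * c) + (4 * L + 1)"
  have K: "0 < K" using par L0 c by (simp add: K_def add_nonneg_pos)
  have "\<forall>\<^sub>F n::nat in sequentially. 3 \<le> n"
    by (rule eventually_ge_at_top)
  moreover have "\<forall>\<^sub>F n in sequentially. B \<le> real n"
    by real_asymp
  moreover have "\<forall>\<^sub>F n in sequentially. 1 \<le> c * ln (real n)"
    using c by real_asymp
  moreover have "\<forall>\<^sub>F n in sequentially. 2 * c * ln (real n) \<le> real n"
    using c by real_asymp
  moreover have "\<forall>\<^sub>F n in sequentially. 2 * c * (ln (real n))\<^sup>2 \<le> 4 * real n powr (1/2)"
    using c by real_asymp
  moreover have "\<forall>\<^sub>F n in sequentially. (4 * L + 1) * real n powr (-2) \<le> real n powr (-1/2)"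
    using L0 by real_asymp
  ultimately have "\<forall>\<^sub>F n in sequentially. \<forall>(Q::real) \<tau> (a::real) (b::real). real n powr (- 1 / 2) \<le> Q \<longrightarrow>
    prob {\<omega>\<in>space M. X 0 \<omega> \<in> ray \<tau> a b} \<le> Q \<longrightarrow>
    prob {\<omega>\<in>space M. K * sqrt (n * Q) * ln n
        < \<bar>(\<Sum>i=1..n. indicator (ray \<tau> a b) (X (int i) \<omega>)) - n * prob {\<omega>\<in>space M. X 0 \<omega> \<in> ray \<tau> a b}\<bar>}
      \<le> real n powr (- \<kappa>)"
  proof eventually_elim
    case (elim n)
    show ?case
    proof (intro allI impI)
      fix Q a b :: real and \<tau>
      assume Q: "real n powr (- 1 / 2) \<le> Q"
        and p: "prob {\<omega>\<in>space M. X 0 \<omega> \<in> ray \<tau> a b} \<le> Q"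
      define p where "p = prob {\<omega>\<in>space M. X 0 \<omega> \<in> ray \<tau> a b}"
      define m where "m = nat \<lceil>c * ln n\<rceil>"
      have n: "3 \<le> real n" "0 < real n" using elim by auto
      have ln1: "1 \<le> ln (real n)"
        using ln_mono[of "exp 1" "real n"] exp_le n by simp
      have m_ge: "c * ln n \<le> m" by (simp add: m_def) linarith
      have m_le: "m \<le> 2 * c * ln n" using elim by (simp add: m_def) linarith
      have m: "0 < m" using m_ge elim by (cases m) auto
      have mn: "real m \<le> n" using m_le elim by linarith
      have Q0: "0 < Q" using Q n by (intro less_le_trans[OF _ Q]) simp
      obtain Y where ind: "\<And>c. indep_vars (\<lambda>_. borel) Y {i. i mod int m = c}"
        and mom: "\<And>i. (\<integral>\<^sup>+ \<omega>. ennreal (\<bar>X i \<omega> - Y i \<omega>\<bar> powr \<alpha>) \<partial>M) \<le> ennreal (B * r ^ m)"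
        using approx[of m] by blast
      have rvY[measurable]: "random_variable borel (Y i)" for i
        using ind[of "i mod int m"] by (auto simp: indep_vars_def)
      define \<delta> where "\<delta> = real n powr (-2)"
      define \<eta> where "\<eta> = real n powr (- (\<kappa> + 3))"
      have close: "prob {\<omega>\<in>space M. \<delta> < \<bar>X i \<omega> - Y i \<omega>\<bar>} \<le> \<eta>" for i
      proof -
        have "r ^ m = exp (m * ln r)" using par by (simp add: exp_of_nat_mult)
        also have "\<dots> \<le> exp (c * ln n * ln r)"
          using m_ge lnr by (intro exp_mono mult_right_mono_neg) auto
        also have "c * ln n * ln r = (c * ln r) * ln n" by simp
        also have "c * ln r = - (\<kappa> + 4 + 2 * \<alpha>)" using lnr by (simp add: c_def)
        also have "exp (- (\<kappa> + 4 + 2 * \<alpha>) * ln n) = real n powr (- (\<kappa> + 4 + 2 * \<alpha>))"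
          using n by (simp add: powr_def)
        finally have rm: "r ^ m \<le> real n powr (- (\<kappa> + 4 + 2 * \<alpha>))" .
        have "prob {\<omega>\<in>space M. \<delta> < \<bar>X i \<omega> - Y i \<omega>\<bar>} \<le> \<delta> powr (- \<alpha>) * (B * r ^ m)"
          using par n by (intro prob_gt_le_moment mom) (auto simp: \<delta>_def)
        also have "\<dots> \<le> real n powr (2 * \<alpha>) * (n * real n powr (- (\<kappa> + 4 + 2 * \<alpha>)))"
          unfolding \<delta>_def powr_powr using rm elim par by (intro mult_mono) auto
        also have "\<dots> = real n powr (2 * \<alpha>) * (real n powr 1 * real n powr (- (\<kappa> + 4 + 2 * \<alpha>)))"
          using n by simp
        also have "\<dots> = \<eta>"
          unfolding \<eta>_def powr_add[symmetric] by (simp add: algebra_simps)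
        finally show ?thesis .
      qed
      have \<eta>_le: "\<eta> \<le> \<delta>"
        unfolding \<eta>_def \<delta>_def using n par by (intro powr_mono) auto
      have bias: "4 * L * \<delta> + \<eta> \<le> (4 * L + 1) * \<delta>" using \<eta>_le by (simp add: algebra_simps)
      have q: "p + (4 * L * \<delta> + \<eta>) \<le> 2 * Q"
      proof -
        have "(4 * L + 1) * \<delta> \<le> Q"
          using elim Q by (auto simp: \<delta>_def)
        then show ?thesis using bias p by (simp add: p_def)
      qed
      \<comment> \<open>Chosen so that the quadratic term of the exponent, l^2 (2 n / m) (2 Q),
        equals ln n.\<close>
      define l where "l = sqrt (m * ln n / (4 * n * Q))"
      have l0: "0 < l" using m n Q0 ln1 by (simp add: l_def)
      \<comment> \<open>Here the lower bound on Q enters: m ln n is of order (ln n)^2, while n Q is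
        at least sqrt n.\<close>
      have l1: "l \<le> 1"
      proof -
        have "m * ln n \<le> 2 * c * ln n * ln n" using m_le ln1 by (intro mult_right_mono) auto
        also have "\<dots> \<le> 4 * real n powr (1/2)" using elim by (simp add: power2_eq_square algebra_simps)
        also have "real n powr (1/2) = n * real n powr (-1/2)"
          using n powr_add[of "real n" 1 "-1/2"] by simp
        also have "\<dots> \<le> n * Q" using Q n by (intro mult_left_mono) auto
        finally have "m * ln n \<le> 4 * n * Q" by simp
        then show ?thesis unfolding l_def using n Q0 by (simp add: real_sqrt_le_1_iff)
      qed
      \<comment> \<open>The linear term is then - (\<kappa> + 4) ln n; the quadratic one gives back
        a single ln n.\<close>
      define s where "s = (\<kappa> + 4) * ln n / l"
      have l_sq: "l\<^sup>2 = m * ln n / (4 * n * Q)"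
        unfolding l_def using n Q0 ln1 by (intro real_sqrt_pow2) auto
      have "l\<^sup>2 * (real (n div m + 1) * (2 * Q)) \<le> l\<^sup>2 * ((2 * n / m) * (2 * Q))"
      proof -
        have "real (n div m + 1) \<le> real n / m + 1" using of_nat_div_le_of_nat[of n m, where 'a=real] by simp
        also have "\<dots> \<le> 2 * n / m" using m mn by (simp add: field_simps)
        finally show ?thesis using Q0 by (intro mult_left_mono mult_right_mono) auto
      qed
      also have "\<dots> = ln n" unfolding l_sq using m n Q0 by (simp add: field_simps)
      finally have "l\<^sup>2 * (real (n div m + 1) * (2 * Q)) \<le> ln n" .
      moreover have "l * s = (\<kappa> + 4) * ln n" using l0 by (simp add: s_def)
      ultimately have expo: "- l * s + l\<^sup>2 * (real (n div m + 1) * (2 * Q)) \<le> - (\<kappa> + 3) * ln n"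
        by (simp add: left_diff_distrib distrib_right)
      have ms: "m * s \<le> (\<kappa> + 4) * sqrt (8 * c) * (sqrt (n * Q) * ln n)"
      proof -
        \<comment> \<open>Squaring removes the root in l; m \<le> 2 c ln n then produces 8 c n Q (ln
          n)^2, the source of the constant in K.\<close>
        have "(m * ln n / l)\<^sup>2 = (m * ln n) * (4 * n * Q)"
          unfolding power_divide l_sq using m n ln1 Q0 by (simp add: power2_eq_square field_simps)
        also have "\<dots> \<le> (2 * c * ln n * ln n) * (4 * n * Q)"
          using m_le n ln1 Q0 by (intro mult_right_mono) auto
        also have "\<dots> = (sqrt (8 * c) * (sqrt (n * Q) * ln n))\<^sup>2"
          using c n Q0 ln1 by (simp add: power_mult_distrib power2_eq_square[of "ln n"])
        finally have "m * ln n / l \<le> sqrt (8 * c) * (sqrt (n * Q) * ln n)"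
          by (rule power2_le_imp_le) (use c n Q0 ln1 in auto)
        then have "(\<kappa> + 4) * (m * ln n / l) \<le> (\<kappa> + 4) * (sqrt (8 * c) * (sqrt (n * Q) * ln n))"
          using par by (intro mult_left_mono) auto
        then show ?thesis by (simp add: s_def algebra_simps)
      qed
      have "n * (4 * L * \<delta> + \<eta>) \<le> n * ((4 * L + 1) * \<delta>)"
        using bias n by (intro mult_left_mono) auto
      also have "\<dots> = (4 * L + 1) * (n * \<delta>)" by simp
      also have "n * \<delta> = real n powr (-1)"
        unfolding \<delta>_def using n powr_add[of "real n" 1 "-2"] by simp
      also have "(4 * L + 1) * real n powr (-1) \<le> (4 * L + 1) * (sqrt (n * Q) * ln n)"
      proof (intro mult_left_mono)
        have "1 \<le> real n powr (1/2)" using n by (intro ge_one_powr_ge_zero) auto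
        also have "real n powr (1/2) = n * real n powr (-1/2)"
          using n powr_add[of "real n" 1 "-1/2"] by simp
        also have "\<dots> \<le> n * Q" using Q n by (intro mult_left_mono) auto
        finally have "1 * 1 \<le> sqrt (n * Q) * ln n" using ln1 by (intro mult_mono) auto
        moreover have "real n powr (-1) \<le> 1" using n by (simp add: powr_minus field_simps)
        ultimately show "real n powr (-1) \<le> sqrt (n * Q) * ln n" by linarith
      qed (use L0 in auto)
      finally have thr: "m * s + n * (4 * L * \<delta> + \<eta>) \<le> K * sqrt (n * Q) * ln n"
        using ms by (simp add: K_def algebra_simps)
      let ?dev = "\<lambda>\<omega>. \<bar>(\<Sum>i=1..n. indicator (ray \<tau> a b) (X (int i) \<omega>)) - n * p\<bar>"
      have "prob {\<omega>\<in>space M. K * sqrt (n * Q) * ln n < ?dev \<omega>}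
          \<le> prob {\<omega>\<in>space M. m * s + n * (4 * L * \<delta> + \<eta>) < ?dev \<omega>}"
        using thr by (intro finite_measure_mono) auto
      also have "\<dots> \<le> n * \<eta> + 2 * (m * exp (- l * s + l\<^sup>2 * ((n div m + 1) * (2 * Q))))"
        unfolding p_def
        by (rule count_deviation_of_approximation[OF rvX law L m ind close _ _ l0 l1])
          (use q in \<open>auto simp: \<delta>_def p_def\<close>)
      also have "\<dots> \<le> n * \<eta> + 2 * (n * exp (- (\<kappa> + 3) * ln n))"
        using expo mn by (intro add_left_mono mult_left_mono mult_mono) auto
      also have "exp (- (\<kappa> + 3) * ln n) = \<eta>" using n by (simp add: \<eta>_def powr_def)
      \<comment> \<open>The bound 3 \<le> n trades the three terms for one more factor n; the
        exponent \<kappa> + 3 has room for it.\<close>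
      also have "n * \<eta> + 2 * (n * \<eta>) \<le> n * (n * \<eta>)" 
        using n by (simp add: \<eta>_def)
      also have "\<dots> = real n powr 1 * (real n powr 1 * \<eta>)" using n by simp
      also have "\<dots> = real n powr (- 1 - \<kappa>)"
        unfolding \<eta>_def powr_add[symmetric] by simp
      also have "\<dots> \<le> real n powr (- \<kappa>)" using n by (intro powr_mono) auto
      finally show "prob {\<omega>\<in>space M. K * sqrt (n * Q) * ln n
        < \<bar>(\<Sum>i=1..n. indicator (ray \<tau> a b) (X (int i) \<omega>)) - n * prob {\<omega>\<in>space M. X 0 \<omega> \<in> ray \<tau> a b}\<bar>}
        \<le> real n powr (- \<kappa>)" by (simp add: p_def)
    qed
  qed
  with K show ?thesis by blast
qed

section \<open>Oscillation of the empirical distribution function\<close>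

text \<open>At stage n the grid has mesh 1 / n and covers [-W, W], so there are O(n^2) events of
  probability at most n^-4, and their union has summable probability of order n^-2.\<close>

lemma borel_cantelli_grid:
  fixes M :: "'a measure" and E :: "nat \<Rightarrow> bool \<Rightarrow> int \<Rightarrow> int \<Rightarrow> 'a set" and W :: nat
  assumes "prob_space M"
    and E[measurable]: "\<And>n \<tau> k l. E n \<tau> k l \<in> sets M"
    and le: "\<forall>\<^sub>F n in sequentially. \<forall>\<tau> k l. measure M (E n \<tau> k l) \<le> real n powr (-4)"
  shows "AE \<omega> in M. \<forall>\<^sub>F n in sequentially.
    \<forall>\<tau>. \<forall>k\<in>{- int (W * n)..int (W * n)}. \<forall>l\<in>{- int (W * n)..int (W * n)}. \<omega> \<notin> E n \<tau> k l"
proof -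
  interpret prob_space M by fact
  define T where "T n = {- int (W * n)..int (W * n)}" for n
  have cardT: "card (T n) = 2 * W * n + 1" for n
    by (simp add: T_def nat_add_distrib nat_mult_distrib)
  define A where "A n = (\<Union>\<tau>\<in>UNIV. \<Union>k\<in>T n. \<Union>l\<in>T n. E n \<tau> k l)" for n
  have [measurable]: "A n \<in> sets M" for n
    unfolding A_def T_def by (intro sets.finite_UN) auto
  have "\<forall>\<^sub>F n in sequentially. prob (A n) \<le> 2 * (2 * W + 1)\<^sup>2 * real n powr (-2)"
    using le eventually_gt_at_top[of 0]
  proof eventually_elim
    case (elim n)
    have "prob (A n) \<le> (\<Sum>\<tau>\<in>UNIV. prob (\<Union>k\<in>T n. \<Union>l\<in>T n. E n \<tau> k l))"
      unfolding A_def T_def by (intro finite_measure_subadditive_finite) auto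
    also have "\<dots> \<le> (\<Sum>\<tau>\<in>(UNIV::bool set). \<Sum>k\<in>T n. prob (\<Union>l\<in>T n. E n \<tau> k l))"
      unfolding T_def by (intro sum_mono finite_measure_subadditive_finite) auto
    also have "\<dots> \<le> (\<Sum>\<tau>\<in>(UNIV::bool set). \<Sum>k\<in>T n. \<Sum>l\<in>T n. prob (E n \<tau> k l))"
      unfolding T_def by (intro sum_mono finite_measure_subadditive_finite) auto
    also have "\<dots> \<le> (\<Sum>\<tau>\<in>(UNIV::bool set). \<Sum>k\<in>T n. \<Sum>l\<in>T n. real n powr (-4))"
      using elim by (intro sum_mono) auto
    also have "\<dots> = 2 * (real (card (T n)))\<^sup>2 * real n powr (-4)"
      by (simp add: power2_eq_square)
    also have "\<dots> \<le> 2 * ((2 * W + 1) * real n)\<^sup>2 * real n powr (-4)"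
    proof -
      have "real (card (T n)) \<le> (2 * W + 1) * real n"
        using elim by (simp add: cardT algebra_simps)
      then show ?thesis by (intro mult_right_mono mult_left_mono power_mono) auto
    qed
    also have "\<dots> = 2 * (2 * W + 1)\<^sup>2 * (real n powr 2 * real n powr (-4))"
      using elim by (simp add: power_mult_distrib powr_numeral)
    also have "real n powr 2 * real n powr (-4) = real n powr (-2)"
      unfolding powr_add[symmetric] by simp
    finally show ?case .
  qed
  then have "\<forall>\<^sub>F n in sequentially. norm (prob (A n)) \<le> 2 * (2 * W + 1)\<^sup>2 * real n powr (-2)"
    by simp
  moreover have "summable (\<lambda>n. 2 * (2 * W + 1)\<^sup>2 * real n powr (-2))"
    by (intro summable_mult) (simp add: summable_real_powr_iff)
  ultimately have "summable (\<lambda>n. prob (A n))"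
    by (rule summable_comparison_test_ev)
  then have "AE \<omega> in M. \<forall>\<^sub>F n in sequentially. \<omega> \<in> space M - A n"
    by (intro borel_cantelli_AE1) (auto simp: emeasure_eq_measure)
  then show ?thesis
  proof eventually_elim
    case (elim \<omega>)
    then show ?case by eventually_elim (auto simp: A_def T_def)
  qed
qed

text \<open>The margin of one unit in the bound on x keeps the right neighbour k + 1 inside the
  grid.\<close>

lemma floor_grid:
  fixes x :: real and n W :: nat
  assumes n: "0 < n" and x: "\<bar>x\<bar> \<le> real W - 1"
  defines "k \<equiv> \<lfloor>x * n\<rfloor>"
  shows "k \<in> {- int (W * n)..int (W * n)}" "k + 1 \<in> {- int (W * n)..int (W * n)}"
    "real_of_int k / n \<le> x" "x \<le> real_of_int (k + 1) / n" "real_of_int (k + 1) / n = real_of_int k / n + 1 / n"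
proof -
  have "\<bar>x * n\<bar> \<le> (real W - 1) * n"
    using x by (simp add: abs_mult mult_right_mono)
  also have "\<dots> \<le> real (W * n) - 1" using n by (simp add: algebra_simps)
  finally have "- real_of_int (int (W * n)) \<le> x * n" "x * n \<le> real_of_int (int (W * n)) - 1"
    by (auto simp: abs_le_iff)
  then have "- int (W * n) \<le> k" "k \<le> int (W * n) - 1"
    unfolding k_def by linarith+
  then show "k \<in> {- int (W * n)..int (W * n)}" "k + 1 \<in> {- int (W * n)..int (W * n)}" by auto
  show "real_of_int k / n \<le> x" "x \<le> real_of_int (k + 1) / n"
    using n unfolding k_def by (simp_all add: field_simps) linarith
  show "real_of_int (k + 1) / n = real_of_int k / n + 1 / n" by (simp add: add_divide_distrib)
qed

text \<open>By monotonicity H x lies between its values at the neighbouring grid points, and F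
  changes by at most L / n from either of them to x.\<close>

lemma cdf_error_from_grid:
  fixes H F :: "real \<Rightarrow> real" and n W :: nat
  assumes n: "0 < n" and H: "mono H"
    and L0: "0 \<le> L" and Lip: "\<And>u v. u \<le> v \<Longrightarrow> F v - F u \<le> L * (v - u)"
    and grid: "\<And>l. l \<in> {- int (W * n)..int (W * n)} \<Longrightarrow> \<bar>H (real_of_int l / n) - F (real_of_int l / n)\<bar> \<le> A"
    and x: "\<bar>x\<bar> \<le> real W - 1"
  shows "\<bar>H x - F x\<bar> \<le> A + L / n"
proof -
  define k where "k = \<lfloor>x * n\<rfloor>"
  define u where "u = real_of_int k / n"
  define v where "v = real_of_int (k + 1) / n"
  have k: "k \<in> {- int (W * n)..int (W * n)}" "k + 1 \<in> {- int (W * n)..int (W * n)}"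
    and uv: "u \<le> x" "x \<le> v" "v = u + 1 / n"
    using floor_grid[OF n x, folded k_def] unfolding u_def v_def by blast+
  have "F v - F x \<le> L * (v - x)" "F x - F u \<le> L * (x - u)"
    using uv by (auto intro!: Lip)
  moreover have "L * (v - x) \<le> L * (1 / n)" "L * (x - u) \<le> L * (1 / n)"
    by (intro mult_left_mono L0; use uv in linarith)+
  moreover have "\<bar>H u - F u\<bar> \<le> A" "\<bar>H v - F v\<bar> \<le> A"
    unfolding u_def v_def by (intro grid k)+
  moreover have "H u \<le> H x" "H x \<le> H v" using uv H by (auto dest: monoD)
  ultimately show ?thesis by (simp add: abs_le_iff)
qed

text \<open>The increment of H is bounded above by that between the outer grid neighbours of x and
  y, and below by that between the inner ones. The outer pair is up to 2 / n further apart, hence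
  the 2 / n in the condition on Q.\<close>

lemma increment_error_from_grid:
  fixes H F :: "real \<Rightarrow> real" and n W :: nat
  assumes n: "0 < n" and H: "mono H" and F: "mono F"
    and L0: "0 \<le> L" and Lip: "\<And>u v. u \<le> v \<Longrightarrow> F v - F u \<le> L * (v - u)"
    and grid: "\<And>k l. k \<in> {- int (W * n)..int (W * n)} \<Longrightarrow> l \<in> {- int (W * n)..int (W * n)} \<Longrightarrow> k \<le> l \<Longrightarrow>
      F (real_of_int l / n) - F (real_of_int k / n) \<le> Q \<Longrightarrow>
      \<bar>H (real_of_int l / n) - H (real_of_int k / n) - (F (real_of_int l / n) - F (real_of_int k / n))\<bar> \<le> w"
    and xy: "x \<le> y" "\<bar>x\<bar> \<le> real W - 1" "\<bar>y\<bar> \<le> real W - 1"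
    and Q: "L * (y - x + 2 / n) \<le> Q" and w: "0 \<le> w"
  shows "\<bar>H y - H x - (F y - F x)\<bar> \<le> w + 2 * (L / n)"
proof -
  define k where "k = \<lfloor>x * n\<rfloor>"
  define l where "l = \<lfloor>y * n\<rfloor>"
  define g where "g i = real_of_int i / n" for i
  have k: "k \<in> {- int (W * n)..int (W * n)}" "k + 1 \<in> {- int (W * n)..int (W * n)}"
    and xg: "g k \<le> x" "x \<le> g (k + 1)"
    using floor_grid[OF n xy(2), folded k_def] unfolding g_def by blast+
  have l: "l \<in> {- int (W * n)..int (W * n)}" "l + 1 \<in> {- int (W * n)..int (W * n)}"
    and yg: "g l \<le> y" "y \<le> g (l + 1)"
    using floor_grid[OF n xy(3), folded l_def] unfolding g_def by blast+
  have step: "g (i + 1) = g i + 1 / n" for i by (simp add: g_def add_divide_distrib)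
  have kl: "k \<le> l" unfolding k_def l_def using xy n by (intro floor_mono mult_right_mono) auto
  have small: "F v - F u \<le> L / n" if "u \<le> v" "v \<le> u + 1 / n" for u v
  proof -
    have "F v - F u \<le> L * (v - u)" using that by (intro Lip)
    also have "\<dots> \<le> L * (1 / n)" using that L0 by (intro mult_left_mono) auto
    finally show ?thesis by simp
  qed
  have near: "F x - F (g k) \<le> L / n" "F (g (k + 1)) - F x \<le> L / n"
      "F y - F (g l) \<le> L / n" "F (g (l + 1)) - F y \<le> L / n"
    using xg yg step by (auto intro!: small)
  have grid': "\<bar>H (g j) - H (g i) - (F (g j) - F (g i))\<bar> \<le> w"
    if "i \<in> {- int (W * n)..int (W * n)}" "j \<in> {- int (W * n)..int (W * n)}" "i \<le> j"
      "g j - g i \<le> y - x + 2 / n" for i j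
  proof -
    have "g i \<le> g j" using that n by (simp add: g_def divide_right_mono)
    then have "F (g j) - F (g i) \<le> L * (g j - g i)" by (rule Lip)
    also have "\<dots> \<le> L * (y - x + 2 / n)" using that L0 by (intro mult_left_mono)
    also note Q
    finally show ?thesis using grid[of i j] that unfolding g_def by blast
  qed
  have "\<bar>H (g (l + 1)) - H (g k) - (F (g (l + 1)) - F (g k))\<bar> \<le> w"
    using xg yg step[of k] step[of l] kl by (intro grid' k l) auto
  moreover have "H (g k) \<le> H x" "H y \<le> H (g (l + 1))" using xg yg H by (auto dest: monoD)
  ultimately have up: "H y - H x - (F y - F x) \<le> w + 2 * (L / n)"
    using near by (simp add: abs_le_iff)
  have lo: "- (w + 2 * (L / n)) \<le> H y - H x - (F y - F x)"
  \<comment> \<open>If x and y share a cell there is no inner pair in the right order; but then F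
    increases by at most L / n and H does not decrease.\<close>
  proof (cases "k = l")
    case True
    then have "F (g (l + 1)) - F (g k) \<le> L / n" using step[of k] by (intro small) auto
    moreover have "F (g k) \<le> F x" "F y \<le> F (g (l + 1))" using xg yg F by (auto dest: monoD)
    moreover have "H x \<le> H y" using xy H by (auto dest: monoD)
    moreover have "0 \<le> L / n" using L0 by simp
    ultimately show ?thesis using w by linarith
  next
    case False
    then have "\<bar>H (g l) - H (g (k + 1)) - (F (g l) - F (g (k + 1)))\<bar> \<le> w"
      using xg yg step[of k] kl by (intro grid' k l) (auto intro: add_increasing2)
    moreover have "H x \<le> H (g (k + 1))" "H (g l) \<le> H y" using xg yg H by (auto dest: monoD)
    ultimately show ?thesis using near by (simp add: abs_le_iff)
  qed
  from up lo show ?thesis by (simp add: abs_le_iff)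
qed

section \<open>Quantiles\<close>

text \<open>The deterministic core. The condition on A traps the quantile q of H in [x - b, x + b].
  Passing below and above q shows that F q differs from p + (p - H x) by at most w, and Taylor
  expansion turns F q - F x into f x (q - x) up to L b^2. Points near q are used as well as q
  itself, hence the radius 2 b in the hypothesis on w.\<close>

lemma quantile_bahadur:
  fixes H F f :: "real \<Rightarrow> real"
  assumes H: "mono H" and Fx: "F x = p" and cont: "\<And>y. isCont F y"
    and taylor: "\<And>y. \<bar>F y - F x - f x * (y - x)\<bar> \<le> L * (y - x)\<^sup>2"
    and c: "0 < c" "c \<le> f x" and b: "0 < b" "L * b \<le> c / 2" "A < c * b / 2"
    and A: "\<bar>H (x + b) - F (x + b)\<bar> \<le> A" "\<bar>H (x - b) - F (x - b)\<bar> \<le> A"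
    and w: "\<And>y. \<bar>y - x\<bar> \<le> 2 * b \<Longrightarrow> \<bar>H y - H x - (F y - F x)\<bar> \<le> w"
  shows "\<bar>quantile H p - x - (p - H x) / f x\<bar> \<le> (w + L * b\<^sup>2) / c"
proof -
  define S where "S = {y. p \<le> H y}"
  define q where "q = Inf S"
  have fx: "0 < f x" using c by simp
  have L0: "0 \<le> L" using taylor[of "x + 1"] by simp
  have cb: "c * b \<le> f x * b" using c b by (intro mult_right_mono) auto
  \<comment> \<open>The remainder costs at most half of the linear gain c b, so F is at least c b /
    2 away from p at x - b and x + b, which exceeds the error A.\<close>
  have Lb: "L * b\<^sup>2 \<le> c * b / 2"
    using mult_right_mono[OF b(2), of b] b(1) by (simp add: power2_eq_square)
  have "F x + f x * b - L * b\<^sup>2 \<le> F (x + b)" and Fxb: "F (x - b) \<le> F x - f x * b + L * b\<^sup>2"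
    using taylor[of "x + b"] taylor[of "x - b"] by (simp_all add: abs_le_iff)
  then have "p \<le> H (x + b)" using A(1) cb Lb b(3) Fx by linarith
  then have "x + b \<in> S" by (simp add: S_def)
  have lower: "x - b \<le> y" if "y \<in> S" for y
  proof (rule ccontr)
    assume "\<not> x - b \<le> y"
    then have "H y \<le> H (x - b)" by (intro monoD[OF H]) simp
    moreover have "H (x - b) < p" using A(2) Fxb cb Lb b(3) Fx by linarith
    moreover have "p \<le> H y" using that unfolding S_def by blast
    ultimately show False by linarith
  qed
  then have bdd: "bdd_below S" by (rule bdd_belowI)
  have ne: "S \<noteq> {}" using \<open>x + b \<in> S\<close> by blast
  have q: "x - b \<le> q" "q \<le> x + b"
    unfolding q_def by (rule cInf_greatest[OF ne lower], assumption) (rule cInf_lower[OF \<open>x + b \<in> S\<close> bdd])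
  have below: "H y < p" if "y < q" for y
    using that cInf_lower[OF _ bdd, of y] by (force simp: q_def S_def)
  have above: "p \<le> H y" if qy: "q < y" for y
  proof -
    obtain z where "z \<in> S" "z < y" using cInf_lessD[OF ne qy[unfolded q_def]] by blast
    then show ?thesis using monoD[OF H, of z y] by (simp add: S_def)
  qed
  have F_lim: "(F \<longlongrightarrow> F q) (at_left q)" "(F \<longlongrightarrow> F q) (at_right q)"
    using cont[of q] by (auto simp: isCont_def intro: filterlim_mono[OF _ order_refl at_le])
  \<comment> \<open>H may jump at q, so \<open>H q\<close> need not be p. Only H < p to the left and
    p \<le> H to the right are used, and continuity of F carries the bounds to q.\<close>
  have up: "F q \<le> p + (p - H x) + w"
  proof (rule tendsto_upperbound[OF F_lim(1)])
    have "\<forall>\<^sub>F y in at_left q. y \<in> {q - b<..<q}" using b by (intro eventually_at_left_real) auto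
    then show "\<forall>\<^sub>F y in at_left q. F y \<le> p + (p - H x) + w"
    proof eventually_elim
      case (elim y)
      have "\<bar>H y - H x - (F y - F x)\<bar> \<le> w" using elim q by (intro w) auto
      then show ?case using below[of y] elim Fx by (simp add: abs_le_iff)
    qed
  qed simp
  have lo: "p + (p - H x) - w \<le> F q"
  proof (rule tendsto_lowerbound[OF F_lim(2)])
    have "\<forall>\<^sub>F y in at_right q. y \<in> {q<..<q + b}" using b by (intro eventually_at_right_real) auto
    then show "\<forall>\<^sub>F y in at_right q. p + (p - H x) - w \<le> F y"
    proof eventually_elim
      case (elim y)
      have "\<bar>H y - H x - (F y - F x)\<bar> \<le> w" using elim q by (intro w) auto
      then show ?case using above[of y] elim Fx by (simp add: abs_le_iff)
    qed
  qed simp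
  have "\<bar>q - x\<bar>\<^sup>2 \<le> b\<^sup>2" using q by (intro power_mono) auto
  then have "L * (q - x)\<^sup>2 \<le> L * b\<^sup>2" using L0 by (intro mult_left_mono) auto
  with taylor[of q] up lo Fx have lin: "\<bar>f x * (q - x) - (p - H x)\<bar> \<le> w + L * b\<^sup>2"
    by (simp add: abs_le_iff)
  have "\<bar>q - x - (p - H x) / f x\<bar> = \<bar>f x * (q - x) - (p - H x)\<bar> / f x"
  proof -
    have "q - x - (p - H x) / f x = (f x * (q - x) - (p - H x)) / f x"
      using fx by (simp add: diff_divide_distrib)
    then show ?thesis using fx by (simp only: abs_divide abs_of_pos)
  qed
  also have "\<dots> \<le> (w + L * b\<^sup>2) / c" using lin c by (intro frac_le) auto
  finally show ?thesis by (simp add: quantile_def q_def S_def)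
qed

text \<open>The superlevel set is closed, nonempty and bounded below, so it contains its infimum,
  giving p \<le> F there; the intermediate value theorem gives a point with value p, which the
  quantile cannot exceed.\<close>

lemma quantile_of_continuous_cdf:
  fixes F :: "real \<Rightarrow> real"
  assumes mono: "mono F" and cont: "\<And>y. isCont F y"
    and lim: "(F \<longlongrightarrow> 0) at_bot" "(F \<longlongrightarrow> 1) at_top" and p: "0 < p" "p < 1"
  shows "F (quantile F p) = p" and "\<And>y. p \<le> F y \<Longrightarrow> quantile F p \<le> y"
proof -
  have "\<forall>\<^sub>F y in at_bot. F y < p" "\<forall>\<^sub>F y in at_top. p < F y"
    using order_tendstoD(2)[OF lim(1) p(1)] order_tendstoD(1)[OF lim(2) p(2)] by auto
  then obtain u v where u: "\<And>y. y \<le> u \<Longrightarrow> F y < p" and v: "p < F v"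
    by (auto simp: eventually_at_bot_linorder eventually_at_top_linorder)
  define S where "S = {y. p \<le> F y}"
  have lower: "u \<le> y" if "y \<in> S" for y
    using u[of y] that by (force simp: S_def)
  then have bdd: "bdd_below S" by (rule bdd_belowI)
  have "v \<in> S" using v by (simp add: S_def)
  have le: "quantile F p \<le> y" if "p \<le> F y" for y
    unfolding quantile_def using bdd that by (intro cInf_lower) (auto simp: S_def)
  then show "\<And>y. p \<le> F y \<Longrightarrow> quantile F p \<le> y" .
  have "closed S" unfolding S_def using cont by (intro closed_Collect_le continuous_at_imp_continuous_on) auto
  then have "quantile F p \<in> S"
    unfolding quantile_def using closed_contains_Inf[of S] bdd \<open>v \<in> S\<close> by (auto simp: S_def)
  moreover have "\<exists>y. u \<le> y \<and> y \<le> v \<and> F y = p"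
    using u[of u] v lower[OF \<open>v \<in> S\<close>] cont by (intro IVT) auto
  then obtain y where "F y = p" by blast
  then have "F (quantile F p) \<le> p" using le[of y] monoD[OF mono] by force
  ultimately show "F (quantile F p) = p" by (simp add: S_def)
qed

text \<open>Continuity of f makes the fundamental theorem of calculus apply at every point rather
  than almost everywhere. The interval of radius 1 around x has x in its interior, so the derivative
  within it is the full derivative.\<close>

lemma cdf_has_derivative_density:
  fixes M :: "'a measure" and X :: "'a \<Rightarrow> real" and f :: "real \<Rightarrow> real"
  assumes "prob_space M" and dist: "distributed M lborel X (\<lambda>x. ennreal (f x))"
    and f0: "\<And>x. 0 \<le> f x" and cont: "\<And>x. isCont f x"
  shows "(cdf (distr M borel X) has_real_derivative f x) (at x)"
proof -
  interpret prob_space M by fact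
  define D where "D = distr M borel X"
  have X[measurable]: "random_variable borel X"
    using distributed_measurable[OF dist] by simp
  interpret D: real_distribution D unfolding D_def by (rule real_distribution_distr[OF X])
  have D_dens: "D = density lborel (\<lambda>x. ennreal (f x))"
    using distributed_distr_eq_density[OF dist] unfolding D_def
    by (metis distr_cong sets_lborel)
  have f_meas[measurable]: "f \<in> borel_measurable borel"
    using cont by (intro borel_measurable_continuous_onI continuous_at_imp_continuous_on) auto
  have incr: "cdf D v - cdf D u = integral {u..v} f" if "u \<le> v" for u v
  proof (cases "u = v")
    case False
    then have "u < v" using that by simp
    have contI: "continuous_on {u..v} f" using cont by (intro continuous_at_imp_continuous_on) auto
    have int: "integrable lborel (\<lambda>x. indicator {u..v} x * f x)"
      using borel_integrable_atLeastAtMost'[OF contI] by (simp add: set_integrable_def)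
    have "emeasure D {u<..v} = (\<integral>\<^sup>+x. ennreal (f x) * indicator {u<..v} x \<partial>lborel)"
      unfolding D_dens by (rule emeasure_density) auto
    also have "\<dots> = (\<integral>\<^sup>+x. ennreal (indicator {u..v} x * f x) \<partial>lborel)"
      using AE_lborel_singleton[of u]
      by (intro nn_integral_cong_AE) (auto elim!: eventually_mono simp: indicator_def)
    also have "\<dots> = ennreal (\<integral>x. indicator {u..v} x * f x \<partial>lborel)"
      using int f0 by (intro nn_integral_eq_integral) auto
    also have "(\<integral>x. indicator {u..v} x * f x \<partial>lborel) = integral {u..v} f"
      using set_borel_integral_eq_integral(2)[OF borel_integrable_atLeastAtMost'[OF contI]]
      by (simp add: set_lebesgue_integral_def)
    finally have "measure D {u<..v} = integral {u..v} f"
      using f0 by (simp add: measure_def integral_nonneg integrable_continuous_real[OF contI])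
    then show ?thesis using D.cdf_diff_eq[OF \<open>u < v\<close>] by simp
  qed simp
  have "((\<lambda>v. cdf D (x - 1) + integral {x - 1..v} f) has_real_derivative f x) (at x within {x - 1..x + 1})"
    using cont by (auto intro!: derivative_eq_intros integral_has_real_derivative continuous_at_imp_continuous_on)
  then have "(cdf D has_real_derivative f x) (at x within {x - 1..x + 1})"
    by (rule has_field_derivative_transform_within[where d=1]) (auto simp: incr[symmetric])
  then show ?thesis by (simp add: D_def at_within_Icc_at)
qed

text \<open>Two mean value inequalities, for f and then for F minus its linear part, use only a
  bound on \<open>deriv f\<close>, not its continuity; the price is the constant L instead of L /
  2.\<close>

lemma taylor_second_order_bound:
  fixes F f :: "real \<Rightarrow> real"
  assumes F: "\<And>x. (F has_real_derivative f x) (at x)"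
    and f: "\<And>x. f differentiable at x" and L: "\<And>x. \<bar>deriv f x\<bar> \<le> L"
  shows "\<bar>F y - F x - f x * (y - x)\<bar> \<le> L * (y - x)\<^sup>2"
proof -
  have f': "(f has_real_derivative deriv f z) (at z)" for z
    using f[of z] by (simp add: DERIV_deriv_iff_real_differentiable)
  have fL: "\<bar>f z - f x\<bar> \<le> L * \<bar>z - x\<bar>" for z
    using field_differentiable_bound[of UNIV f "deriv f" L z x] f' L
    by (simp add: has_field_derivative_at_within)
  have "\<bar>(F y - f x * y) - (F x - f x * x)\<bar> \<le> (L * \<bar>y - x\<bar>) * \<bar>y - x\<bar>"
  proof -
    have "norm ((F y - f x * y) - (F x - f x * x)) \<le> (L * \<bar>y - x\<bar>) * norm (y - x)"
    proof (rule field_differentiable_bound[of "closed_segment x y" "\<lambda>z. F z - f x * z" "\<lambda>z. f z - f x"])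
      fix z assume z: "z \<in> closed_segment x y"
      show "((\<lambda>z. F z - f x * z) has_real_derivative f z - f x) (at z within closed_segment x y)"
        by (auto intro!: derivative_eq_intros has_field_derivative_at_within[OF F])
      have "\<bar>z - x\<bar> \<le> \<bar>y - x\<bar>" using z by (auto simp: closed_segment_eq_real_ivl split: if_splits)
      moreover have "0 \<le> L" using L[of 0] by simp
      ultimately show "norm (f z - f x) \<le> L * \<bar>y - x\<bar>"
        using fL[of z] by (auto intro: order_trans mult_left_mono)
    qed auto
    then show ?thesis by simp
  qed
  moreover have "(F y - f x * y) - (F x - f x * x) = F y - F x - f x * (y - x)"
    by (simp add: right_diff_distrib)
  moreover have "(L * \<bar>y - x\<bar>) * \<bar>y - x\<bar> = L * (y - x)\<^sup>2"
    by (simp add: mult.assoc power2_eq_square)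
  ultimately show ?thesis by (simp only:)
qed

section \<open>The Bahadur representation\<close>

lemma mono_empirical_cdf: "mono (empirical_cdf X n \<omega>)"
  unfolding empirical_cdf_def
  by (intro monoI divide_right_mono sum_mono) (auto simp: indicator_def)

text \<open>Dividing counts by n turns flag \<open>False\<close> into values of the empirical
  distribution function and flag \<open>True\<close> into its increments, so one concentration bound
  yields both conclusions.\<close>

lemma (in prob_space) empirical_cdf_grid_deviation:
  fixes X :: "int \<Rightarrow> 'a \<Rightarrow> real" and F :: "real \<Rightarrow> real" and K :: real and Q :: "nat \<Rightarrow> real" and W :: nat
  assumes rvX[measurable]: "\<And>i. random_variable borel (X i)"
    and F_def: "F = cdf (distr M borel (X 0))"
    and conc: "\<forall>\<^sub>F n in sequentially. \<forall>(Q::real) \<tau> (a::real) (b::real). real n powr (- 1 / 2) \<le> Q \<longrightarrow>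
      prob {\<omega>\<in>space M. X 0 \<omega> \<in> ray \<tau> a b} \<le> Q \<longrightarrow>
      prob {\<omega>\<in>space M. K * sqrt (n * Q) * ln n
          < \<bar>(\<Sum>i=1..n. indicator (ray \<tau> a b) (X (int i) \<omega>)) - n * prob {\<omega>\<in>space M. X 0 \<omega> \<in> ray \<tau> a b}\<bar>}
        \<le> real n powr (- 4)"
    and Q: "\<forall>\<^sub>F n in sequentially. real n powr (- 1 / 2) \<le> Q n"
  shows "AE \<omega> in M. \<forall>\<^sub>F n in sequentially.
    (\<forall>l\<in>{- int (W * n)..int (W * n)}. F (real_of_int l / n) \<le> Q n \<longrightarrow>
      \<bar>empirical_cdf X n \<omega> (real_of_int l / n) - F (real_of_int l / n)\<bar> \<le> K * sqrt (n * Q n) * ln n / n) \<and>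
    (\<forall>k\<in>{- int (W * n)..int (W * n)}. \<forall>l\<in>{- int (W * n)..int (W * n)}. k \<le> l \<longrightarrow>
      F (real_of_int l / n) - F (real_of_int k / n) \<le> Q n \<longrightarrow>
      \<bar>empirical_cdf X n \<omega> (real_of_int l / n) - empirical_cdf X n \<omega> (real_of_int k / n)
        - (F (real_of_int l / n) - F (real_of_int k / n))\<bar> \<le> K * sqrt (n * Q n) * ln n / n)"
proof -
  interpret D: real_distribution "distr M borel (X 0)" by (rule real_distribution_distr[OF rvX])
  define P where "P \<tau> a b = prob {\<omega>\<in>space M. X 0 \<omega> \<in> ray \<tau> a b}" for \<tau> a b
  define N where "N n \<omega> \<tau> a b = (\<Sum>i=1..n. indicator (ray \<tau> a b) (X (int i) \<omega>) :: real)" for n \<omega> \<tau> a b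
  \<comment> \<open>Pairs whose probability exceeds \<open>Q n\<close> get the empty event, so the
    bound n^-4 holds for all pairs.\<close>
  define E where "E n \<tau> k l = (if P \<tau> (real_of_int k / n) (real_of_int l / n) \<le> Q n then
      {\<omega>\<in>space M. K * sqrt (n * Q n) * ln n < \<bar>N n \<omega> \<tau> (real_of_int k / n) (real_of_int l / n)
         - n * P \<tau> (real_of_int k / n) (real_of_int l / n)\<bar>} else {})" for n :: nat and \<tau> and k l :: int
  have P_measure: "P \<tau> a b = measure (distr M borel (X 0)) (ray \<tau> a b)" for \<tau> a b
    unfolding P_def by (subst measure_distr) (auto intro!: arg_cong[where f=prob])
  have P_half: "P False a b = F b" for a b
    by (simp add: P_measure F_def cdf_def ray_def atMost_def)
  have P_interval: "P True a b = F b - F a" if "a \<le> b" for a b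
  proof (cases "a = b")
    case False
    then have "a < b" using that by simp
    moreover have "ray True a b = {a<..b}" by (auto simp: ray_def)
    ultimately show ?thesis by (simp add: P_measure F_def D.cdf_diff_eq)
  next
    case True
    then have "ray True a b = {}" by (auto simp: ray_def)
    then show ?thesis using True by (simp add: P_measure)
  qed
  have N_half: "N n \<omega> False a b = n * empirical_cdf X n \<omega> b" for n \<omega> a b
    by (cases "n = 0") (simp_all add: N_def empirical_cdf_def ray_def atMost_def)
  have N_interval: "N n \<omega> True a b = n * (empirical_cdf X n \<omega> b - empirical_cdf X n \<omega> a)" if "a \<le> b" for n \<omega> a b
  proof -
    have "indicator (ray True a b) x = indicator (ray False a b) x - (indicator (ray False a a) x :: real)" for x
      using that by (auto simp: ray_def indicator_def)
    then have "N n \<omega> True a b = N n \<omega> False a b - N n \<omega> False a a"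
      by (simp add: N_def sum_subtractf)
    then show ?thesis by (simp add: N_half right_diff_distrib)
  qed
  have "E n \<tau> k l \<in> sets M" for n \<tau> k l
    unfolding E_def N_def by (cases "P \<tau> (real_of_int k / n) (real_of_int l / n) \<le> Q n") simp_all
  moreover have "\<forall>\<^sub>F n in sequentially. \<forall>\<tau> k l. prob (E n \<tau> k l) \<le> real n powr (- 4)"
    using conc Q by eventually_elim (simp add: E_def P_def N_def)
  ultimately have "AE \<omega> in M. \<forall>\<^sub>F n in sequentially.
      \<forall>\<tau>. \<forall>k\<in>{- int (W * n)..int (W * n)}. \<forall>l\<in>{- int (W * n)..int (W * n)}. \<omega> \<notin> E n \<tau> k l"
    by (intro borel_cantelli_grid prob_space_axioms)
  with AE_space show ?thesis
  proof eventually_elim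
    case (elim \<omega>)
    from elim(2) eventually_gt_at_top[of 0] show ?case
    proof eventually_elim
      case (elim n)
      define B where "B = K * sqrt (n * Q n) * ln n"
      have n: "0 < real n" using elim by simp
      have scale: "\<bar>x\<bar> \<le> B / n" if "\<not> B < \<bar>n * x\<bar>" for x :: real
        using that n by (simp add: abs_mult field_simps)
      have dev: "\<not> B < \<bar>N n \<omega> \<tau> (real_of_int k / n) (real_of_int l / n) - n * P \<tau> (real_of_int k / n) (real_of_int l / n)\<bar>"
        if "k \<in> {- int (W * n)..int (W * n)}" "l \<in> {- int (W * n)..int (W * n)}"
          "P \<tau> (real_of_int k / n) (real_of_int l / n) \<le> Q n" for \<tau> k l
      proof -
        have "\<omega> \<notin> E n \<tau> k l" using elim(1) that by blast
        then show ?thesis using that(3) \<open>\<omega> \<in> space M\<close> by (simp add: E_def B_def)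
      qed
      show ?case
        unfolding B_def[symmetric]
      proof (intro conjI ballI impI)
        fix l assume l: "l \<in> {- int (W * n)..int (W * n)}" and F: "F (real_of_int l / n) \<le> Q n"
        \<comment> \<open>A half-line ignores its left parameter, so l can fill both places.\<close>
        show "\<bar>empirical_cdf X n \<omega> (real_of_int l / n) - F (real_of_int l / n)\<bar> \<le> B / n"
          by (rule scale, use dev[OF l l, of False] F in \<open>simp add: P_half N_half right_diff_distrib\<close>)
      next
        fix k l assume kl: "k \<in> {- int (W * n)..int (W * n)}" "l \<in> {- int (W * n)..int (W * n)}" "k \<le> l"
          and F: "F (real_of_int l / n) - F (real_of_int k / n) \<le> Q n"
        have kln: "real_of_int k / n \<le> real_of_int l / n" using kl n by (simp add: divide_right_mono)
        show "\<bar>empirical_cdf X n \<omega> (real_of_int l / n) - empirical_cdf X n \<omega> (real_of_int k / n)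
            - (F (real_of_int l / n) - F (real_of_int k / n))\<bar> \<le> B / n"
          by (intro scale, use dev[OF kl(1,2), of True] F kln in \<open>simp add: P_interval N_interval right_diff_distrib\<close>)
      qed
    qed
  qed
qed

theorem theorem4:
  fixes M :: "'w measure" and S :: "'e measure"
    and \<epsilon> \<epsilon>' :: "int \<Rightarrow> 'w \<Rightarrow> 'e"
    and G :: "(nat \<Rightarrow> 'e) \<Rightarrow> real"
    and X :: "int \<Rightarrow> 'w \<Rightarrow> real"
    and F f :: "real \<Rightarrow> real"
    and \<xi> :: "real \<Rightarrow> real"
    and p\<^sub>0 p\<^sub>1 :: real
  assumes "prob_space M"
    and "iid_process M S \<epsilon>"
    and "independent_copy M S \<epsilon> \<epsilon>'"
    and "G \<in> borel_measurable (PiM UNIV (\<lambda>_. S))"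
    and X_def: "X = causal_process G \<epsilon>"
    and F_def: "F = cdf (distr M borel (X 0))"
    and \<xi>_def: "\<xi> = quantile F"
    and "\<And>x. 0 \<le> f x"
    and "distributed M lborel (X 0) (\<lambda>x. ennreal (f x))"
    and "geometric_moment_contracting M G \<epsilon> \<epsilon>'"
    and "\<And>x. f differentiable at x"
    and "bdd_above (range (\<lambda>x. f x + \<bar>deriv f x\<bar>))"
    and "0 < p\<^sub>0" and "p\<^sub>0 < p\<^sub>1" and "p\<^sub>1 < 1"
    and "(INF p\<in>{p\<^sub>0..p\<^sub>1}. f (\<xi> p)) > 0"
  shows "O_as M
    (\<lambda>n \<omega>. SUP p\<in>{p\<^sub>0..p\<^sub>1}.
       \<bar>quantile (empirical_cdf X n \<omega>) p - \<xi> p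
         - (p - empirical_cdf X n \<omega> (\<xi> p)) / f (\<xi> p)\<bar>)
    (\<lambda>n. real n powr (- 3 / 4) * ln (real n) powr (3 / 2))"
proof -
  interpret prob_space M by fact
  note iid = assms(2) and copy = assms(3) and G_meas = assms(4) and f0 = assms(8) and dist = assms(9)
    and gmc = assms(10) and f_diff = assms(11) and f_bdd = assms(12) and p01 = assms(13-15) and c_pos = assms(16)

  \<comment> \<open>Regularity of the distribution function\<close>
  obtain L0 where "\<And>x. f x + \<bar>deriv f x\<bar> \<le> L0" using f_bdd by (auto simp: bdd_above_def)
  \<comment> \<open>One constant bounds f and |f'|, hence the Lipschitz constant and the Taylor
    remainder; the maximum with 1 makes it positive and later gives 1 \<le> \<Delta>.\<close>
  define L where "L = max 1 L0"
  have L1: "1 \<le> L" by (simp add: L_def)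
  have "f x + \<bar>deriv f x\<bar> \<le> L" for x using \<open>f x + \<bar>deriv f x\<bar> \<le> L0\<close> by (simp add: L_def)
  then have f_le: "\<bar>f x\<bar> \<le> L" and f'_le: "\<bar>deriv f x\<bar> \<le> L" for x
    using f0[of x] by (smt (verit))+
  have f_cont: "isCont f x" for x
    using f_diff[of x] by (rule differentiable_imp_continuous_within)
  have F_deriv: "(F has_real_derivative f x) (at x)" for x
    unfolding F_def by (rule cdf_has_derivative_density[OF prob_space_axioms dist f0 f_cont])
  have F_cont: "isCont F x" for x using F_deriv by (rule DERIV_isCont)
  have taylor: "\<bar>F y - F x - f x * (y - x)\<bar> \<le> L * (y - x)\<^sup>2" for x y
    by (rule taylor_second_order_bound[OF F_deriv f_diff f'_le])
  have Lip: "F v - F u \<le> L * (v - u)" if "u \<le> v" for u v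
    using field_differentiable_bound[of UNIV F f L v u] F_deriv f_le that
    by (simp add: has_field_derivative_at_within abs_le_iff)

  \<comment> \<open>Measurability and stationarity of the process\<close>
  have X0: "X i = (\<lambda>\<omega>. G (\<lambda>j. \<epsilon> (i - int j) \<omega>))" for i
    by (rule ext) (simp add: X_def causal_process_def)
  have rvX[measurable]: "random_variable borel (X i)" for i
    unfolding X0 by (rule measurable_compose[OF distr_iid_past(1)[OF iid] G_meas])
  have law: "distr M borel (X i) = distr M borel (X 0)" for i
  proof -
    have "distr M borel (X i) = distr (\<Pi>\<^sub>M j\<in>(UNIV::nat set). distr M S (\<epsilon> 0)) borel G" for i
      unfolding X0 distr_iid_past(2)[OF iid, of i, symmetric]
      by (subst distr_distr[OF G_meas distr_iid_past(1)[OF iid]]) (simp add: comp_def)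
    then show ?thesis by simp
  qed
  interpret D: real_distribution "distr M borel (X 0)" by (rule real_distribution_distr[OF rvX])
  have F_mono: "mono F" unfolding F_def by (intro monoI D.cdf_nondecreasing)
  have F_le1: "F x \<le> 1" for x unfolding F_def by (rule D.cdf_bounded_prob)
  have F_lim: "(F \<longlongrightarrow> 0) at_bot" "(F \<longlongrightarrow> 1) at_top"
    unfolding F_def by (rule D.cdf_lim_at_bot D.cdf_lim_at_top_prob)+
  have L_prob: "prob {\<omega>\<in>space M. u < X 0 \<omega> \<and> X 0 \<omega> \<le> v} \<le> L * (v - u)" if "u \<le> v" for u v
  proof (cases "u = v")
    case True
    then have empty: "{\<omega>\<in>space M. u < X 0 \<omega> \<and> X 0 \<omega> \<le> v} = {}" by auto
    show ?thesis unfolding empty using True by simp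
  next
    case False
    then have "u < v" using that by simp
    have "prob {\<omega>\<in>space M. u < X 0 \<omega> \<and> X 0 \<omega> \<le> v} = measure (distr M borel (X 0)) {u<..v}"
      by (subst measure_distr) (auto intro!: arg_cong[where f=prob])
    also have "\<dots> = F v - F u" unfolding F_def by (rule D.cdf_diff_eq[OF \<open>u < v\<close>, symmetric])
    finally show ?thesis using Lip[OF that] by simp
  qed

  \<comment> \<open>Concentration of counts, with \<kappa> = 4 to outweigh the O(n^2) pairs of grid
    points\<close>
  obtain \<alpha> C r where par: "0 < \<alpha>" "0 < C" "0 < r" "r < 1"
    and moment: "\<And>n::nat. (\<integral>\<^sup>+ \<omega>. ennreal (\<bar>causal_process G \<epsilon> (int n) \<omega>
                - causal_process G (coupled_innovations \<epsilon> \<epsilon>') (int n) \<omega>\<bar> powr \<alpha>) \<partial>M)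
           \<le> ennreal (C * r ^ n)"
    using gmc by (auto simp: geometric_moment_contracting_def)
  have approx: "\<exists>Y. (\<forall>c. indep_vars (\<lambda>_. borel) Y {i. i mod int m = c}) \<and>
      (\<forall>i. (\<integral>\<^sup>+ \<omega>. ennreal (\<bar>X i \<omega> - Y i \<omega>\<bar> powr \<alpha>) \<partial>M) \<le> ennreal ((2 * C) * r ^ m))" for m
    using m_dependent_approximation[OF iid copy G_meas moment[of m]] par
    by (simp add: X_def mult.assoc)
  have "\<exists>K>0. \<forall>\<^sub>F n in sequentially. \<forall>(Q::real) \<tau> (a::real) (b::real). real n powr (- 1 / 2) \<le> Q \<longrightarrow>
    prob {\<omega>\<in>space M. X 0 \<omega> \<in> ray \<tau> a b} \<le> Q \<longrightarrow>
    prob {\<omega>\<in>space M. K * sqrt (n * Q) * ln n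
        < \<bar>(\<Sum>i=1..n. indicator (ray \<tau> a b) (X (int i) \<omega>)) - n * prob {\<omega>\<in>space M. X 0 \<omega> \<in> ray \<tau> a b}\<bar>}
      \<le> real n powr (- 4)"
    by (rule count_concentration[where X=X and L=L and \<alpha>=\<alpha> and B="2 * C" and r=r and \<kappa>=4, OF rvX law L_prob])
      (use par approx in simp_all)
  then obtain K where K: "0 < K" and conc: "\<forall>\<^sub>F n in sequentially. \<forall>(Q::real) \<tau> (a::real) (b::real). real n powr (- 1 / 2) \<le> Q \<longrightarrow>
    prob {\<omega>\<in>space M. X 0 \<omega> \<in> ray \<tau> a b} \<le> Q \<longrightarrow>
    prob {\<omega>\<in>space M. K * sqrt (n * Q) * ln n
        < \<bar>(\<Sum>i=1..n. indicator (ray \<tau> a b) (X (int i) \<omega>)) - n * prob {\<omega>\<in>space M. X 0 \<omega> \<in> ray \<tau> a b}\<bar>}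
      \<le> real n powr (- 4)"
    by (elim exE conjE)

  \<comment> \<open>The range of the quantiles and the choice of scales\<close>
  define c where "c = (INF p\<in>{p\<^sub>0..p\<^sub>1}. f (\<xi> p))"
  have c: "0 < c" using c_pos by (simp add: c_def)
  \<comment> \<open>Nonnegativity of f bounds the family below, so the infimum is a genuine lower
    bound.\<close>
  have c_le: "c \<le> f (\<xi> p)" if "p \<in> {p\<^sub>0..p\<^sub>1}" for p
    unfolding c_def using that f0 by (intro cINF_lower bdd_belowI[of _ 0]) auto
  have F\<xi>: "F (\<xi> p) = p" and \<xi>_le: "\<And>y. p \<le> F y \<Longrightarrow> \<xi> p \<le> y" if "p \<in> {p\<^sub>0..p\<^sub>1}" for p
    using quantile_of_continuous_cdf[OF F_mono F_cont F_lim, of p] p01 that by (auto simp: \<xi>_def)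
  \<comment> \<open>All quantiles concerned lie between the two extreme ones. Of the added 2, one
    unit leaves room for neighbourhoods of radius 2 b \<le> 1, the other is the margin of the
    grid.\<close>
  define W where "W = nat \<lceil>\<bar>\<xi> p\<^sub>0\<bar> + \<bar>\<xi> p\<^sub>1\<bar>\<rceil> + 2"
  have \<xi>_bound: "\<bar>\<xi> p\<bar> + 1 \<le> real W - 1" if p: "p \<in> {p\<^sub>0..p\<^sub>1}" for p
  proof -
    have "\<xi> p\<^sub>0 \<le> \<xi> p" using p p01 by (intro \<xi>_le) (auto simp: F\<xi>)
    moreover have "\<xi> p \<le> \<xi> p\<^sub>1" using p p01 by (intro \<xi>_le[OF p]) (auto simp: F\<xi>)
    ultimately have "\<bar>\<xi> p\<bar> \<le> \<bar>\<xi> p\<^sub>0\<bar> + \<bar>\<xi> p\<^sub>1\<bar>" by linarith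
    also have "\<dots> \<le> real (nat \<lceil>\<bar>\<xi> p\<^sub>0\<bar> + \<bar>\<xi> p\<^sub>1\<bar>\<rceil>)" by (rule real_nat_ceiling_ge)
    finally show ?thesis by (simp add: W_def)
  qed

  \<comment> \<open>With e = n^(-1/2) ln n this makes c b / 2 = 2 (K + L) e, twice the uniform error
    of the empirical distribution function.\<close>
  define \<beta> where "\<beta> = 4 * (K + L) / c"
  have \<beta>: "0 < \<beta>" using K L1 c by (simp add: \<beta>_def)
  define b where "b n = \<beta> * (real n powr (- 1 / 2) * ln n)" for n :: nat
  \<comment> \<open>Then Q bounds L (2 b + 2 / n), as the increment bound over distances up to 2 b
    demands.\<close>
  define \<Delta> where "\<Delta> = 2 * L * \<beta> + 2 * L"
  have \<Delta>: "1 \<le> \<Delta>"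
  proof -
    have "0 \<le> 2 * L * \<beta>" using L1 \<beta> by simp
    then show ?thesis unfolding \<Delta>_def using L1 by linarith
  qed
  define Q where "Q n = \<Delta> * (real n powr (- 1 / 2) * ln n)" for n :: nat
  define R where "R n = real n powr (- 3 / 4) * ln (real n) powr (3 / 2)" for n :: nat
  define w where "w n = K * sqrt (n * Q n) * ln n / n" for n :: nat

  have ev3: "\<forall>\<^sub>F n in sequentially. 3 \<le> n" by (rule eventually_ge_at_top)
  \<comment> \<open>Instance with Q constantly 1: F is at most 1, so the side condition holds at
    every grid point.\<close>
  have "\<forall>\<^sub>F n in sequentially. real n powr (- 1 / 2) \<le> 1"
    by real_asymp
  note one = empirical_cdf_grid_deviation[where X=X, OF rvX F_def conc this, of W]
  have "\<forall>\<^sub>F n in sequentially. real n powr (- 1 / 2) \<le> Q n"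
  proof -
    have "\<forall>\<^sub>F n in sequentially. 1 \<le> ln (real n)" by real_asymp
    then show ?thesis
    proof eventually_elim
      case (elim n)
      have "1 * (real n powr (- 1 / 2) * 1) \<le> \<Delta> * (real n powr (- 1 / 2) * ln n)"
        using elim \<Delta> by (intro mult_mono) auto
      then show ?case by (simp add: Q_def)
    qed
  qed
  note two = empirical_cdf_grid_deviation[where X=X, OF rvX F_def conc this, of W]
  have ev_small: "\<forall>\<^sub>F n in sequentially. L * b n \<le> c / 2" "\<forall>\<^sub>F n in sequentially. 2 * b n \<le> 1"
    unfolding b_def using L1 \<beta> c by real_asymp+
  have ev_inv: "\<forall>\<^sub>F n in sequentially. 1 / real n \<le> real n powr (- 1 / 2) * ln n"
    "\<forall>\<^sub>F n in sequentially. 1 / real n \<le> R n"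
    "\<forall>\<^sub>F n in sequentially. (real n powr (- 1 / 2) * ln n)\<^sup>2 \<le> R n"
    unfolding R_def by real_asymp+

  define C' where "C' = (K * sqrt \<Delta> + 2 * L + L * \<beta>\<^sup>2) / c"
  have "AE \<omega> in M. \<forall>\<^sub>F n in sequentially. \<forall>p\<in>{p\<^sub>0..p\<^sub>1}.
      \<bar>quantile (empirical_cdf X n \<omega>) p - \<xi> p - (p - empirical_cdf X n \<omega> (\<xi> p)) / f (\<xi> p)\<bar> \<le> C' * R n"
    using one two
  proof eventually_elim
    case (elim \<omega>)
    from elim ev3 ev_small ev_inv show ?case
    proof eventually_elim
      case (elim n)
      define H where "H = empirical_cdf X n \<omega>"
      define e where "e = real n powr (- 1 / 2) * ln n"
      have n: "0 < n" "3 \<le> real n" using elim by auto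
      have H_mono: "mono H" unfolding H_def by (rule mono_empirical_cdf)
      have ln1: "1 \<le> ln (real n)"
        using ln_mono[of "exp 1" "real n"] exp_le n by simp
      have e0: "0 < e" using n ln1 by (simp add: e_def)
      have b: "0 < b n" "b n = \<beta> * e" using e0 \<beta> by (simp_all add: b_def e_def)
      have sqrt_n: "sqrt (real n) / n = real n powr (- 1 / 2)"
        using n powr_diff[of "real n" "1/2" 1] by (simp add: powr_half_sqrt)
      have w0: "0 \<le> w n" using K n ln1 \<Delta> by (simp add: w_def Q_def)
      have gridH: "\<bar>H (real_of_int l / n) - F (real_of_int l / n)\<bar> \<le> K * e"
        if "l \<in> {- int (W * n)..int (W * n)}" for l
      proof -
        have "\<bar>H (real_of_int l / n) - F (real_of_int l / n)\<bar> \<le> K * sqrt (real n * 1) * ln n / n"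
          unfolding H_def using elim(1) that F_le1 by blast
        also have "\<dots> = K * e" unfolding e_def sqrt_n[symmetric] by simp
        finally show ?thesis .
      qed
      have cdf_err: "\<bar>H x - F x\<bar> \<le> (K + L) * e" if "\<bar>x\<bar> \<le> real W - 1" for x
      proof -
        have "\<bar>H x - F x\<bar> \<le> K * e + L / n"
          by (rule cdf_error_from_grid[OF n(1) H_mono _ Lip gridH that]) (use L1 in simp)
        also have "L / n \<le> L * e"
          using mult_left_mono[of "1 / real n" e L] elim L1 by (simp add: e_def)
        finally show ?thesis by (simp add: algebra_simps)
      qed
      have incr: "\<bar>H y - H x - (F y - F x)\<bar> \<le> w n + 2 * (L / n)"
        if "x \<le> y" "\<bar>x\<bar> \<le> real W - 1" "\<bar>y\<bar> \<le> real W - 1" "y - x \<le> 2 * b n" for x y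
      proof (rule increment_error_from_grid[OF n(1) H_mono F_mono _ Lip _ that(1-3) _ w0])
        show "\<bar>H (real_of_int l / n) - H (real_of_int k / n) - (F (real_of_int l / n) - F (real_of_int k / n))\<bar> \<le> w n"
          if "k \<in> {- int (W * n)..int (W * n)}" "l \<in> {- int (W * n)..int (W * n)}" "k \<le> l"
            "F (real_of_int l / n) - F (real_of_int k / n) \<le> Q n" for k l
          unfolding H_def w_def using elim(2) that by blast
        have "y - x + 2 / n \<le> 2 * (\<beta> * e) + 2 * e"
          using that elim b by (simp add: e_def)
        then have "L * (y - x + 2 / n) \<le> L * (2 * (\<beta> * e) + 2 * e)" using L1 by (intro mult_left_mono) auto
        also have "\<dots> = Q n" by (simp add: Q_def \<Delta>_def e_def algebra_simps)
        finally show "L * (y - x + 2 / n) \<le> Q n" .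
      qed (use L1 in auto)
      \<comment> \<open>The rate emerges here: n Q = \<Delta> n^(1/2) ln n, so its root contributes
        n^(1/4) and half a logarithm.\<close>
      have w_eq: "w n = K * sqrt \<Delta> * R n"
      proof -
        have "sqrt (n * Q n) = sqrt \<Delta> * (sqrt (real n powr (1 / 2)) * sqrt (ln n))"
        proof -
          have "n * Q n = \<Delta> * (real n powr (1 / 2) * ln n)"
            using powr_add[of "real n" 1 "- 1 / 2"] n by (simp add: Q_def)
          then show ?thesis by (simp add: real_sqrt_mult)
        qed
        also have "sqrt (real n powr (1 / 2)) = real n powr (1 / 4)"
          by (simp add: powr_half_sqrt[symmetric] powr_powr)
        also have "sqrt (ln n) = ln n powr (1 / 2)" using ln1 by (simp add: powr_half_sqrt)
        finally have "w n = K * sqrt \<Delta> * ((real n powr (1 / 4) / n) * (ln n powr (1 / 2) * ln n))"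
          by (simp add: w_def)
        also have "real n powr (1 / 4) / n = real n powr (- 3 / 4)"
          using n powr_diff[of "real n" "1 / 4" 1] by simp
        also have "ln n powr (1 / 2) * ln n = ln n powr (3 / 2)"
          using ln1 powr_add[of "ln n" "1 / 2" 1] by simp
        finally show ?thesis by (simp add: R_def)
      qed
      show ?case
      proof
        fix p assume p: "p \<in> {p\<^sub>0..p\<^sub>1}"
        have "\<bar>quantile H p - \<xi> p - (p - H (\<xi> p)) / f (\<xi> p)\<bar> \<le> ((w n + 2 * (L / n)) + L * (b n)\<^sup>2) / c"
        proof (rule quantile_bahadur[where F=F and f=f and x="\<xi> p", OF H_mono F\<xi>[OF p] F_cont taylor c c_le[OF p] b(1) elim(4)])
          have "c * b n / 2 = 2 * ((K + L) * e)" using c by (simp add: b \<beta>_def)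
          then show "(K + L) * e < c * b n / 2" using K L1 e0 by simp
          show "\<bar>H (\<xi> p + b n) - F (\<xi> p + b n)\<bar> \<le> (K + L) * e" "\<bar>H (\<xi> p - b n) - F (\<xi> p - b n)\<bar> \<le> (K + L) * e"
            using \<xi>_bound[OF p] elim b by (auto intro!: cdf_err)
          fix y assume y: "\<bar>y - \<xi> p\<bar> \<le> 2 * b n"
          then have yW: "\<bar>y\<bar> \<le> real W - 1" "\<bar>\<xi> p\<bar> \<le> real W - 1"
            using \<xi>_bound[OF p] elim by linarith+
          show "\<bar>H y - H (\<xi> p) - (F y - F (\<xi> p))\<bar> \<le> w n + 2 * (L / n)"
          \<comment> \<open>\<open>incr\<close> needs ordered arguments; exchanging them only flips
            the sign inside the absolute value.\<close>
          proof (cases "\<xi> p \<le> y")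
            case True
            then show ?thesis using incr[of "\<xi> p" y] y yW by simp
          next
            case False
            then have "\<bar>H (\<xi> p) - H y - (F (\<xi> p) - F y)\<bar> \<le> w n + 2 * (L / n)"
              using y yW by (intro incr) auto
            then show ?thesis by linarith
          qed
        qed
        also have "\<dots> \<le> (K * sqrt \<Delta> * R n + 2 * (L * R n) + L * (\<beta>\<^sup>2 * R n)) / c"
        proof -
          have "L / n \<le> L * R n" using mult_left_mono[of "1 / real n" "R n" L] elim L1 by simp
          moreover have "L * (b n)\<^sup>2 \<le> L * (\<beta>\<^sup>2 * R n)"
            using elim L1 unfolding b(2) power_mult_distrib e_def by (intro mult_left_mono) auto
          ultimately show ?thesis using c w_eq by (intro divide_right_mono) auto
        qed
        also have "\<dots> = C' * R n" by (simp add: C'_def algebra_simps add_divide_distrib)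
        finally show "\<bar>quantile (empirical_cdf X n \<omega>) p - \<xi> p - (p - empirical_cdf X n \<omega> (\<xi> p)) / f (\<xi> p)\<bar> \<le> C' * R n"
          by (simp add: H_def)
      qed
    qed
  qed
  then show ?thesis
    unfolding O_as_def R_def[symmetric]
  proof eventually_elim
    case (elim \<omega>)
    define Z where "Z n p = \<bar>quantile (empirical_cdf X n \<omega>) p - \<xi> p - (p - empirical_cdf X n \<omega> (\<xi> p)) / f (\<xi> p)\<bar>" for n p
    have "\<forall>\<^sub>F n in sequentially. norm ((SUP p\<in>{p\<^sub>0..p\<^sub>1}. Z n p) / R n) \<le> C'"
      using elim ev3
    proof eventually_elim
      case (elim n)
      have ln1: "1 \<le> ln (real n)"
        using ln_mono[of "exp 1" "real n"] exp_le elim by simp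
      have R: "0 < R n" using ln1 elim by (simp add: R_def)
      have le: "Z n p \<le> C' * R n" if "p \<in> {p\<^sub>0..p\<^sub>1}" for p using elim that by (simp add: Z_def)
      \<comment> \<open>The pointwise bound makes the family bounded above, so the real supremum
        dominates the nonnegative value at \<open>p\<^sub>0\<close>; this handles the lower side of
        the norm.\<close>
      have "(SUP p\<in>{p\<^sub>0..p\<^sub>1}. Z n p) \<le> C' * R n" using p01 le by (intro cSUP_least) auto
      moreover have "Z n p\<^sub>0 \<le> (SUP p\<in>{p\<^sub>0..p\<^sub>1}. Z n p)"
        using p01 le by (intro cSUP_upper bdd_aboveI2[where M="C' * R n"]) auto
      moreover have "0 \<le> Z n p\<^sub>0" by (simp add: Z_def)
      ultimately show ?case using R by (simp add: divide_le_eq)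
    qed
    \<comment> \<open>An eventual bound suffices for boundedness of a sequence, so the finitely many
      small n do no harm.\<close>
    then show ?case unfolding Z_def by (rule BfunI)
  qed
qed

end
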